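(* Let $d\ge 2$ and let $U_0,\dots,U_d$ be $d+1$ i.i.d. uniform random points on the unit sphere $\mathcal{S}_{\mathbb{R}^d}=\{x\in\mathbb{R}^d:\|x\|=1\}$. Let $\Delta_d(U_0,\dots,U_d)$ be the $d$-dimensional volume of the simplex with vertices $U_0,\dots,U_d$. Then $$\mathbb{E}\left[\Delta_d(U_0,\dots,U_d)\,\mathbf{1}_{0\in\mathrm{Conv}(P_{U_0^\perp}(U_1),\dots,P_{U_0^\perp}(U_d))}\right]=\frac{1}{2^{d-1}\sqrt{\pi}\,(d-1)!}\;\frac{\Gamma\left(\frac d2\right)^d}{\Gamma\left(\frac{d+1}{2}\right)^{d-1}}.$$
   Context: $P_{u^\perp}$ denotes the orthogonal projection of $\mathbb{R}^d$ onto the linear hyperplane $u^\perp$ orthogonal to the unit vector $u$. $\mathrm{Conv}(\cdot)$ denotes the relative interior of the convex hull of the specified points. $\Gamma$ is the Gamma function. *)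

theory Defs
  imports "HOL-Analysis.Analysis" "HOL-Probability.Probability"
begin

text \<open>
  The uniform distribution on the unit sphere, as a Borel probability measure on the ambient space:
  a set \<open>A\<close> of unit vectors receives the volume of the cone \<open>{t *\<^sub>R x | t x. 0 < t \<and> t \<le> 1 \<and> x \<in> A}\<close>,
  divided by the volume of the unit ball. This is the normalised surface measure.
  The lemmas below show that it is a probability measure carried by the sphere and invariant
  under every orthogonal transformation, which determines it uniquely.
\<close>

definition uniform_sphere :: "'a::euclidean_space measure" where
  "uniform_sphere = distr (uniform_measure lborel (cball 0 1)) borel sgn"

lemma sets_uniform_sphere [simp, measurable_cong]: "sets uniform_sphere = sets borel"
  by (simp add: uniform_sphere_def)

lemma space_uniform_sphere [simp]: "space uniform_sphere = UNIV"
  by (simp add: uniform_sphere_def)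

lemma emeasure_unit_cball_nonzero: "emeasure lborel (cball (0::'a::euclidean_space) 1) \<noteq> 0"
  using content_cball_pos[of 1 "0::'a"] by (auto simp: measure_def)

lemma emeasure_unit_cball_finite: "emeasure lborel (cball (0::'a::euclidean_space) 1) \<noteq> \<infinity>"
  using emeasure_bounded_finite[of "cball (0::'a) 1"] by simp

lemma prob_space_uniform_sphere: "prob_space (uniform_sphere :: 'a::euclidean_space measure)"
  unfolding uniform_sphere_def
  by (intro prob_space.prob_space_distr prob_space_uniform_measure
        emeasure_unit_cball_nonzero emeasure_unit_cball_finite) simp

lemma AE_uniform_sphere: "AE x in (uniform_sphere :: 'a::euclidean_space measure). x \<in> sphere 0 1"
proof -
  have "AE x::'a in lborel. x \<noteq> 0"
    by (rule AE_lborel_singleton)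
  then have "AE x in uniform_measure lborel (cball (0::'a) 1). norm (sgn x) = 1"
    by (intro AE_uniform_measureI) (auto simp: norm_sgn elim!: eventually_mono)
  then show ?thesis
    unfolding uniform_sphere_def by (subst AE_distr_iff) auto
qed

lemma lborel_distr_orthogonal:
  fixes T :: "'a::euclidean_space \<Rightarrow> 'a"
  assumes T: "orthogonal_transformation T"
  shows "distr lborel borel T = lborel"
proof -
  have lin: "linear T"
    using T by (rule orthogonal_transformation_linear)
  have [measurable]: "T \<in> borel_measurable borel"
    using lin by (intro borel_measurable_continuous_onI linear_continuous_on)
                 (simp add: linear_conv_bounded_linear)
  have shift: "(\<integral>\<^sup>+x. f (T x + y) \<partial>lborel) = (\<integral>\<^sup>+x. f (T x) \<partial>lborel)"
    if [measurable]: "f \<in> borel_measurable borel" for f y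
  proof -
    obtain z where z: "y = T z"
      using orthogonal_transformation_surj[OF T] by (metis surjD)
    have "(\<integral>\<^sup>+x. f (T x) \<partial>lborel) = (\<integral>\<^sup>+x. f (T x) \<partial>distr lborel borel ((+) z))"
      by (simp add: lborel_distr_plus)
    also have "\<dots> = (\<integral>\<^sup>+x. f (T x + y) \<partial>lborel)"
      by (subst nn_integral_distr) (auto simp: z linear_add[OF lin] add.commute)
    finally show ?thesis by simp
  qed
  have plus: "(\<integral>\<^sup>+y. indicator A (x + y) \<partial>lborel) = emeasure lborel A"
    if [measurable]: "A \<in> sets borel" for A and x :: 'a
  proof -
    have "emeasure lborel A = (\<integral>\<^sup>+y. indicator A y \<partial>distr lborel borel ((+) x))"
      by (simp add: lborel_distr_plus)
    also have "\<dots> = (\<integral>\<^sup>+y. indicator A (x + y) \<partial>lborel)"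
      by (subst nn_integral_distr) auto
    finally show ?thesis by simp
  qed
  have reflect: "(\<integral>\<^sup>+y. indicator A (x - y) \<partial>lborel) = emeasure lborel A"
    if [measurable]: "A \<in> sets borel" for A and x :: 'a
  proof -
    have "emeasure lborel A = (\<integral>\<^sup>+y. indicator A y \<partial>distr lborel borel (\<lambda>y. x + (-1) *\<^sub>R y))"
      using lborel_affine[of "-1" x] by (simp add: density_1)
    also have "\<dots> = (\<integral>\<^sup>+y. indicator A (x - y) \<partial>lborel)"
      by (subst nn_integral_distr) auto
    finally show ?thesis by simp
  qed
  have vimage: "(\<integral>\<^sup>+x. indicator A (T x) \<partial>lborel) = emeasure lborel (T -` A)"
    if [measurable]: "A \<in> sets borel" for A
  proof -
    have "T -` A \<in> sets lborel"
      using measurable_sets_borel[of T borel A] by simp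
    then have "emeasure lborel (T -` A) = (\<integral>\<^sup>+x. indicator (T -` A) x \<partial>lborel)"
      by (rule nn_integral_indicator[symmetric])
    then show ?thesis
      by (simp add: indicator_def)
  qed
  have key: "emeasure lborel A * emeasure lborel (T -` B) = emeasure lborel (T -` A) * emeasure lborel B"
    if [measurable]: "A \<in> sets borel" "B \<in> sets borel" for A B :: "'a set"
  proof -
    have "emeasure lborel A * emeasure lborel (T -` B)
        = (\<integral>\<^sup>+x. emeasure lborel A * indicator B (T x) \<partial>lborel)"
      by (subst nn_integral_cmult) (auto simp: vimage)
    also have "\<dots> = (\<integral>\<^sup>+x. \<integral>\<^sup>+y. indicator A (T x - y) * indicator B (T x) \<partial>lborel \<partial>lborel)"
      by (subst nn_integral_multc) (auto simp: reflect)
    also have "\<dots> = (\<integral>\<^sup>+y. \<integral>\<^sup>+x. indicator A (T x - y) * indicator B (T x) \<partial>lborel \<partial>lborel)"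
      by (rule lborel_pair.Fubini') measurable
    also have "\<dots> = (\<integral>\<^sup>+y. \<integral>\<^sup>+x. indicator A (T x) * indicator B (T x + y) \<partial>lborel \<partial>lborel)"
    proof (rule nn_integral_cong)
      fix y :: 'a
      show "(\<integral>\<^sup>+x. indicator A (T x - y) * indicator B (T x) \<partial>lborel)
          = (\<integral>\<^sup>+x. indicator A (T x) * (indicator B (T x + y) :: ennreal) \<partial>lborel)"
        using shift[of "\<lambda>x. indicator A (x - y) * indicator B x" y] by simp
    qed
    also have "\<dots> = (\<integral>\<^sup>+x. \<integral>\<^sup>+y. indicator A (T x) * indicator B (T x + y) \<partial>lborel \<partial>lborel)"
      by (rule lborel_pair.Fubini') measurable
    also have "\<dots> = (\<integral>\<^sup>+x. indicator A (T x) * emeasure lborel B \<partial>lborel)"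
      by (subst nn_integral_cmult) (auto simp: plus)
    also have "\<dots> = emeasure lborel (T -` A) * emeasure lborel B"
      by (subst nn_integral_multc) (auto simp: vimage)
    finally show ?thesis .
  qed
  have ball: "T -` cball 0 1 = cball 0 1"
    using T by (auto simp: orthogonal_transformation_norm)
  show ?thesis
  proof (rule measure_eqI)
    fix A assume "A \<in> sets (distr lborel borel T)"
    then have [measurable]: "A \<in> sets borel" by simp
    have "emeasure lborel A * emeasure lborel (cball (0::'a) 1)
        = emeasure lborel (T -` A) * emeasure lborel (cball (0::'a) 1)"
      using key[of A "cball 0 1"] by (simp add: ball)
    then have "emeasure lborel A = emeasure lborel (T -` A)"
      using emeasure_unit_cball_nonzero[where 'a='a] emeasure_unit_cball_finite[where 'a='a]
      by (metis ennreal_mult_divide_eq infinity_ennreal_def)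
    then show "emeasure (distr lborel borel T) A = emeasure lborel A"
      by (simp add: emeasure_distr)
  qed simp
qed

lemma uniform_sphere_orthogonal_invariant:
  fixes T :: "'a::euclidean_space \<Rightarrow> 'a"
  assumes T: "orthogonal_transformation T"
  shows "distr uniform_sphere borel T = uniform_sphere"
proof -
  let ?u = "uniform_measure lborel (cball (0::'a) 1)"
  have lin: "linear T"
    using T by (rule orthogonal_transformation_linear)
  have [measurable]: "T \<in> borel_measurable borel"
    using lin by (intro borel_measurable_continuous_onI linear_continuous_on)
                 (simp add: linear_conv_bounded_linear)
  have ball: "T -` cball 0 1 = cball 0 1"
    using T by (auto simp: orthogonal_transformation_norm)
  have comm: "T (sgn x) = sgn (T x)" for x
    using T by (simp add: sgn_div_norm linear_scale[OF lin] orthogonal_transformation_norm)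
  have inv: "distr ?u borel T = ?u"
  proof (rule measure_eqI)
    fix A assume "A \<in> sets (distr ?u borel T)"
    then have [measurable]: "A \<in> sets borel" by simp
    have [measurable]: "T -` A \<in> sets borel"
      using measurable_sets_borel[of T borel A] by simp
    have "emeasure lborel (cball 0 1 \<inter> A) = emeasure (distr lborel borel T) (cball 0 1 \<inter> A)"
      by (simp add: lborel_distr_orthogonal[OF T])
    also have "\<dots> = emeasure lborel (cball 0 1 \<inter> T -` A)"
      by (subst emeasure_distr) (auto simp: ball vimage_Int)
    finally show "emeasure (distr ?u borel T) A = emeasure ?u A"
      by (simp add: emeasure_distr)
  qed simp
  have "distr uniform_sphere borel T = distr ?u borel (\<lambda>x. sgn (T x))"
    unfolding uniform_sphere_def by (subst distr_distr) (auto simp: comm o_def)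
  also have "\<dots> = distr (distr ?u borel T) borel sgn"
    by (subst distr_distr) (auto simp: o_def)
  also have "\<dots> = uniform_sphere"
    by (simp add: inv uniform_sphere_def)
  finally show ?thesis .
qed

definition proj_perp :: "'a::euclidean_space \<Rightarrow> 'a \<Rightarrow> 'a" where
  "proj_perp u x = x - ((x \<bullet> u) / (u \<bullet> u)) *\<^sub>R u"

lemma proj_perp_eq_closest_point: "proj_perp u x = closest_point {y. orthogonal u y} x"
proof (rule closest_point_unique)
  have hyp: "{y. orthogonal u y} = {y. u \<bullet> y = 0}"
    by (simp add: orthogonal_def)
  show "convex {y. orthogonal u y}" "closed {y. orthogonal u y}"
    by (simp_all add: hyp convex_hyperplane closed_hyperplane)
  show mem: "proj_perp u x \<in> {y. orthogonal u y}"
    by (cases "u = 0") (auto simp: proj_perp_def orthogonal_def inner_diff_right inner_commute)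
  show "\<forall>z\<in>{y. orthogonal u y}. dist x (proj_perp u x) \<le> dist x z"
  proof
    fix z assume z: "z \<in> {y. orthogonal u y}"
    have "orthogonal (x - proj_perp u x) (proj_perp u x - z)"
      using mem z by (simp add: proj_perp_def[of u x, THEN arg_cong[where f="\<lambda>p. x - p"]]
          orthogonal_def inner_diff_right)
    then have "(norm ((x - proj_perp u x) + (proj_perp u x - z)))\<^sup>2
        = (norm (x - proj_perp u x))\<^sup>2 + (norm (proj_perp u x - z))\<^sup>2"
      by (rule norm_add_Pythagorean)
    then have "(norm (x - proj_perp u x))\<^sup>2 \<le> (norm (x - z))\<^sup>2"
      by simp
    then show "dist x (proj_perp u x) \<le> dist x z"
      by (simp add: dist_norm)
  qed
qed

end

theory Submission
  imports Defs
begin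

text \<open>
  Write \<open>x\<^sub>0, \<dots>, x\<^sub>d\<close> for the points, \<open>D = det (x\<^sub>1, \<dots>, x\<^sub>d)\<close>, and \<open>D\<^sub>j\<close> for the same determinant with
  row \<open>j\<close> replaced by \<open>x\<^sub>0\<close>. The volume of the simplex is \<open>\<bar>D - \<Sum>\<^sub>j D\<^sub>j\<bar> / d!\<close> and, for a nondegenerate simplex,
  the projection condition says that all \<open>D\<^sub>j\<close> have the same strict sign.
  By Cramer's rule \<open>D x\<^sub>0 = \<Sum>\<^sub>j D\<^sub>j x\<^sub>j\<close>, so \<open>\<bar>D\<bar> \<le> \<Sum>\<^sub>j \<bar>D\<^sub>j\<bar>\<close> for unit vectors; averaging over the sign of \<open>x\<^sub>0\<close>
  therefore replaces \<open>\<bar>D - \<Sum>\<^sub>j D\<^sub>j\<bar>\<close> by \<open>\<Sum>\<^sub>j \<bar>D\<^sub>j\<bar>\<close>. Averaging over the signs of \<open>x\<^sub>1, \<dots>, x\<^sub>d\<close> then shows that the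
  sign condition holds with conditional probability \<open>2 / 2\<^sup>d\<close>, which leaves \<open>d / 2 ^ (d - 1) * E \<bar>D\<bar> / d!\<close>.
  The mean of \<open>\<bar>D\<bar>\<close> is computed by replacing the rows by unit vectors of the standard basis one at a time: by
  rotation invariance the \<open>k\<close>-th step contributes the mean length of the projection of a uniform
  point of the sphere to \<open>k\<close> coordinates.
\<close>

section \<open>Determinants and the volume of a simplex\<close>

definition det_rows :: "('n::finite \<Rightarrow> real ^ 'n) \<Rightarrow> real" where
  "det_rows x = det (\<chi> i. x i)"

lemma det_rows_upd_add: "det_rows (x(k := a + b)) = det_rows (x(k := a)) + det_rows (x(k := b))"
  using det_row_add[of k "\<lambda>_. a" "\<lambda>_. b" x] by (simp add: det_rows_def fun_upd_def)

lemma det_rows_upd_scale: "det_rows (x(k := c *\<^sub>R a)) = c * det_rows (x(k := a))"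
  using det_row_mul[of k c "\<lambda>_. a" x]
  by (simp add: det_rows_def fun_upd_def scalar_mult_eq_scaleR cong: if_cong)

lemma linear_det_rows_upd: "linear (\<lambda>a. det_rows (x(k := a)))"
  by (rule linearI) (simp_all add: det_rows_upd_add det_rows_upd_scale)

lemma det_rows_eq_0: "i \<noteq> j \<Longrightarrow> x i = x j \<Longrightarrow> det_rows x = 0"
  unfolding det_rows_def by (rule det_identical_rows[of i j]) (auto simp: row_def)

lemma det_rows_scale_all: "det_rows (\<lambda>i. c i *\<^sub>R x i) = (\<Prod>i\<in>UNIV. c i) * det_rows x"
  using det_rows_mul[of c x] by (simp add: det_rows_def scalar_mult_eq_scaleR)

text \<open>Multilinearity gives one term for each set of replaced rows, and a term with
  \<open>a\<close> in two rows is zero, so only single replacements survive. The set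
  \<open>S\<close> carries the induction over rows.\<close>

lemma det_rows_diff_on:
  "det_rows (\<lambda>i. if i \<in> S then x i - a else x i) = det_rows x - (\<Sum>i\<in>S. det_rows (x(i := a)))"
proof -
  have "finite S" by simp
  then show ?thesis
  proof (induction S arbitrary: x)
    case empty
    then show ?case by simp
  next
    case (insert k S)
    define z where "z = (\<lambda>i. if i \<in> S then x i - a else x i)"
    have zk: "z = z(k := x k)"
      using insert by (auto simp: z_def fun_eq_iff)
    have "det_rows (\<lambda>i. if i \<in> insert k S then x i - a else x i) = det_rows (z(k := x k - a))"
      using insert by (intro arg_cong[where f=det_rows]) (auto simp: z_def fun_eq_iff)
    also have "\<dots> = det_rows z - det_rows (z(k := a))"
      using linear_diff[OF linear_det_rows_upd[of z k], of "x k" a] zk by simp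
    \<comment> \<open>With \<open>a\<close> already in row \<open>k\<close>, the induction
      hypothesis for \<open>x(k := a)\<close> produces only corrections in which \<open>a\<close> is
      repeated.\<close>
    also have "z(k := a) = (\<lambda>i. if i \<in> S then (x(k := a)) i - a else (x(k := a)) i)"
      using insert by (auto simp: z_def fun_eq_iff)
    also have "det_rows \<dots> = det_rows (x(k := a)) - (\<Sum>i\<in>S. det_rows ((x(k := a))(i := a)))"
      by (rule insert.IH)
    also have "(\<Sum>i\<in>S. det_rows ((x(k := a))(i := a))) = 0"
    proof (intro sum.neutral ballI)
      fix i assume "i \<in> S"
      with insert(2) show "det_rows ((x(k := a))(i := a)) = 0"
        by (intro det_rows_eq_0[of k i]) auto
    qed
    finally show ?case
      using insert by (simp add: z_def)
  qed
qed

lemma det_rows_diff: "det_rows (\<lambda>i. x i - a) = det_rows x - (\<Sum>i\<in>UNIV. det_rows (x(i := a)))"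
  using det_rows_diff_on[of UNIV x a] by simp

text \<open>With \<open>a\<close> in row \<open>j\<close>, subtracting \<open>a\<close> from the
  other rows is a row operation.\<close>

lemma det_rows_diff_upd: "det_rows ((\<lambda>i. x i - a)(j := a)) = det_rows (x(j := a))"
proof -
  have "(\<lambda>i. x i - a)(j := a) = (\<lambda>i. if i \<in> - {j} then (x(j := a)) i - a else (x(j := a)) i)"
    by auto
  moreover have "(\<Sum>i\<in>- {j}. det_rows ((x(j := a))(i := a))) = 0"
    by (intro sum.neutral ballI det_rows_eq_0[of j]) auto
  ultimately show ?thesis
    by (simp only: det_rows_diff_on)
qed

text \<open>By linearity in row \<open>j\<close> only the term of \<open>x j\<close> survives, every
  other one repeating a row. This reads off coordinates with respect to the rows.\<close>

lemma det_rows_upd_combination: "det_rows (x(j := (\<Sum>i\<in>UNIV. c i *\<^sub>R x i))) = c j * det_rows x"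
proof -
  have "det_rows (x(j := (\<Sum>i\<in>UNIV. c i *\<^sub>R x i))) = (\<Sum>i\<in>UNIV. c i * det_rows (x(j := x i)))"
    by (simp add: linear_sum[OF linear_det_rows_upd] linear_scale[OF linear_det_rows_upd])
  also have "\<dots> = (\<Sum>i\<in>UNIV. if i = j then c j * det_rows x else 0)"
    by (intro sum.cong refl) (auto intro: det_rows_eq_0[of _ j])
  finally show ?thesis by simp
qed

lemma det_rows_nonzero_span:
  assumes "det_rows x \<noteq> 0"
  obtains c where "v = (\<Sum>i\<in>UNIV. c i *\<^sub>R x i)"
proof -
  let ?A = "\<chi> i. x i"
  have "invertible (transpose ?A)"
    using assms by (simp add: det_rows_def invertible_det_nz)
  then obtain w where "transpose ?A *v w = v"
    by (metis invertible_def matrix_vector_mul_assoc matrix_vector_mul_lid)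
  then have "v = (\<Sum>i\<in>UNIV. (w $ i) *\<^sub>R x i)"
    by (simp add: matrix_mult_sum column_transpose row_def scalar_mult_eq_scaleR)
  then show ?thesis by (rule that)
qed

lemma cramer_rows:
  assumes "det_rows x \<noteq> 0"
  shows "det_rows x *\<^sub>R v = (\<Sum>j\<in>UNIV. det_rows (x(j := v)) *\<^sub>R x j)"
proof -
  obtain c where c: "v = (\<Sum>i\<in>UNIV. c i *\<^sub>R x i)"
    using det_rows_nonzero_span[OF assms] by blast
  have "det_rows (x(j := v)) = c j * det_rows x" for j
    unfolding c by (rule det_rows_upd_combination)
  then show ?thesis
    by (simp add: c scaleR_sum_right mult.commute)
qed

text \<open>The library version requires a well-ordered index type, but uses it only to evaluate the
  determinant of a shear.\<close>

lemma measure_linear_image_cart: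
  fixes f :: "real ^ 'n \<Rightarrow> real ^ 'n"
  assumes "linear f" "S \<in> lmeasurable"
  shows "f ` S \<in> lmeasurable" "measure lebesgue (f ` S) = \<bar>det (matrix f)\<bar> * measure lebesgue S"
proof -
  let ?Q = "\<lambda>(f::real^'n \<Rightarrow> real^'n) S.
    f ` S \<in> lmeasurable \<and> measure lebesgue (f ` S) = \<bar>det (matrix f)\<bar> * measure lebesgue S"
  have "\<forall>S\<in>lmeasurable. ?Q f S"
  proof (rule induct_linear_elementary[OF assms(1)]; intro ballI)
    fix f g :: "real^'n \<Rightarrow> real^'n" and S :: "(real^'n) set"
    assume "linear f" "linear g" "\<forall>S\<in>lmeasurable. ?Q f S" "\<forall>S\<in>lmeasurable. ?Q g S" "S \<in> lmeasurable"
    moreover have "(f \<circ> g) ` S = f ` g ` S"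
      by (simp add: image_comp)
    ultimately show "?Q (f \<circ> g) S"
      by (simp only: matrix_compose det_mul abs_mult mult.assoc simp_thms)
  next
    fix f :: "real^'n \<Rightarrow> real^'n" and i S
    assume f: "linear f" and 0: "\<And>x. f x $ i = 0"
    \<comment> \<open>The image misses an axis vector, so \<open>f\<close> is neither onto nor
      injective; the determinant and the measure of the image both vanish.\<close>
    have "f x \<noteq> axis i 1" for x
      using 0[of x] by auto
    then have "\<not> inj f"
      using linear_injective_imp_surjective[OF f] by (metis surjD)
    then show "?Q f S"
      using negligible_linear_singular_image[OF f] det_nz_iff_inj[OF f]
      by (auto simp: negligible_iff_measure)
  next
    fix c and S :: "(real^'n) set"
    assume "S \<in> lmeasurable"
    then show "?Q (\<lambda>x. \<chi> i. c i * x $ i) S"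
      using measurable_stretch[of S c] measure_stretch[of S c]
      by (simp add: det_diagonal matrix_def axis_def)
  next
    fix m n :: 'n and S :: "(real^'n) set"
    assume mn: "m \<noteq> n" and S: "S \<in> lmeasurable"
    let ?h = "\<lambda>v::real^'n. \<chi> i. v $ Transposition.transpose m n i"
    have lin: "linear ?h"
      by (rule linearI) (simp_all add: vec_eq_iff)
    have inv: "?h (?h v) = v" for v
      by (simp add: vec_eq_iff)
    have box: "?h ` cbox a b = cbox (?h a) (?h b)" for a b
    proof -
      have sub: "?h ` cbox a b \<subseteq> cbox (?h a) (?h b)" for a b
        by (auto simp: mem_box_cart)
      \<comment> \<open>The swap is an involution, so the reverse inclusion is \<open>sub\<close>
        for the swapped corners.\<close>
      have "cbox (?h a) (?h b) = ?h ` ?h ` cbox (?h a) (?h b)"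
        by (simp add: image_image inv)
      also have "\<dots> \<subseteq> ?h ` cbox a b"
        using sub[of "?h a" "?h b"] by (intro image_mono) (simp add: inv)
      finally show ?thesis using sub by blast
    qed
    have meq: "measure lebesgue (?h ` cbox a b) = 1 * measure lebesgue (cbox a b)" for a b
    proof (cases "cbox a b = {}")
      case False
      then have "cbox (?h a) (?h b) \<noteq> {}"
        using box[of a b] by auto
      then have "measure lborel (cbox (?h a) (?h b)) = measure lborel (cbox a b)"
        using False prod.permute[OF permutes_swap_id[of m UNIV n], of "\<lambda>i. b $ i - a $ i"]
        by (simp add: content_cbox_cart o_def)
      then show ?thesis by (simp add: box)
    qed auto
    have "matrix ?h = (\<chi> i. mat 1 $ Transposition.transpose m n i)"
      by (auto simp: matrix_def mat_def axis_def vec_eq_iff)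
    then have "\<bar>det (matrix ?h)\<bar> = 1"
      by (simp add: det_permute_rows permutes_swap_id sign_swap_id abs_mult)
    then show "?Q ?h S"
      using measure_linear_sufficient[OF lin S meq] by simp
  next
    fix m n :: 'n and S :: "(real^'n) set"
    assume mn: "m \<noteq> n" and S: "S \<in> lmeasurable"
    let ?h = "\<lambda>v::real^'n. \<chi> i. if i = m then v $ m + v $ n else v $ i"
    have lin: "linear ?h"
      by (rule linearI) (simp_all add: vec_eq_iff algebra_simps)
    \<comment> \<open>The shear is the elementary row operation that adds row \<open>n\<close> of
      the identity to row \<open>m\<close>.\<close>
    have "matrix ?h = (\<chi> k. if k = m then row m (mat 1) + 1 *s row n (mat 1) else row k (mat 1))"
      by (auto simp: matrix_def mat_def axis_def row_def vec_eq_iff)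
    then have det: "det (matrix ?h) = 1"
      by (simp only: det_row_operation[OF mn] det_I)
    have meq: "measure lebesgue (?h ` cbox a b) = 1 * measure lebesgue (cbox a b)" for a b
    proof (cases "cbox a b = {}")
      case False
      then obtain v where v: "v \<in> cbox a b" by blast
      \<comment> \<open>The formula for sheared boxes asks for a nonnegative lower corner in
        coordinate \<open>n\<close>; translation by \<open>s\<close> moves it to 0.\<close>
      define s :: "real^'n" where "s = (\<chi> i. if i = n then - a $ n else 0)"
      have sh: "?h ` cbox a b = (+) (- ?h s) ` ?h ` ((+) s ` cbox a b)"
        by (simp add: image_image linear_add[OF lin])
      have "(+) s ` cbox a b = cbox (s + a) (s + b)"
        by (simp add: cbox_translation)
      moreover have "0 \<le> (s + a) $ n" by (simp add: s_def)
      moreover have "cbox (s + a) (s + b) \<noteq> {}"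
        using False cbox_translation[of s a b] by auto
      ultimately have "measure lebesgue (?h ` ((+) s ` cbox a b)) = measure lebesgue (cbox (s + a) (s + b))"
        using measure_shear_interval[OF mn, of "s + a" "s + b"] by simp
      also have "\<dots> = measure lebesgue (cbox a b)"
        using measure_translation[of s "cbox a b"] cbox_translation[of s a b] by simp
      finally show ?thesis
        by (subst sh, subst measure_translation) simp
    qed auto
    show "?Q ?h S"
      using measure_linear_sufficient[OF lin S meq] det by simp
  qed
  with assms(2) show "f ` S \<in> lmeasurable" "measure lebesgue (f ` S) = \<bar>det (matrix f)\<bar> * measure lebesgue S"
    by blast+
qed

text \<open>The simplex is the image of the standard simplex, of volume
  \<open>1 / fact CARD('n)\<close>, under the affine map sending 0 to \<open>a\<close> and the axis
  vector of index \<open>i\<close> to \<open>x i\<close>.\<close>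

lemma measure_simplex:
  fixes x :: "'n::finite \<Rightarrow> real ^ 'n"
  shows "measure lborel (convex hull (insert a (range x)))
       = \<bar>det_rows (\<lambda>i. x i - a)\<bar> / fact CARD('n)"
proof -
  let ?S = "convex hull (insert 0 Basis) :: (real^'n) set"
  \<comment> \<open>Transposed, so that the rows \<open>x i - a\<close> become columns, the images
    of the axis vectors.\<close>
  define g where "g z = transpose (\<chi> i. x i - a) *v z" for z
  have comp: "compact (convex hull X)" if "finite X" for X :: "(real^'n) set"
    using that by (rule finite_imp_compact_convex_hull)
  have lin: "linear g"
    unfolding g_def by (rule matrix_vector_mul_linear)
  have det: "det (matrix g) = det_rows (\<lambda>i. x i - a)"
    unfolding g_def matrix_of_matrix_vector_mul det_transpose det_rows_def ..
  have ax: "g (axis i 1) = x i - a" for i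
    unfolding g_def by (simp only: matrix_vector_mult_basis column_transpose) (simp add: row_def vec_eq_iff)
  have "g ` insert 0 Basis = insert 0 (range (\<lambda>i. x i - a))"
    using linear_0[OF lin] by (auto simp: Basis_vec_def ax image_iff)
  then have "insert a (range x) = (+) a ` g ` insert 0 Basis"
    by (simp add: image_image)
  then have "convex hull (insert a (range x)) = (+) a ` g ` ?S"
    by (simp only: convex_hull_translation convex_hull_linear_image[OF lin])
  then have "measure lebesgue (convex hull (insert a (range x))) = measure lebesgue (g ` ?S)"
    by (simp only: measure_translation)
  also have "\<dots> = \<bar>det_rows (\<lambda>i. x i - a)\<bar> * measure lebesgue ?S"
    using measure_linear_image_cart[OF lin, of ?S] comp[of "insert 0 Basis"]
    by (simp add: lmeasurable_compact det)
  also have "measure lebesgue ?S = measure lborel ?S"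
    using comp[of "insert 0 Basis"] by (intro measure_completion) (simp add: borel_compact)
  finally have "measure lebesgue (convex hull (insert a (range x)))
      = \<bar>det_rows (\<lambda>i. x i - a)\<bar> / fact CARD('n)"
    by (simp add: content_std_simplex)
  moreover have "measure lebesgue (convex hull (insert a (range x)))
      = measure lborel (convex hull (insert a (range x)))"
    using comp[of "insert a (range x)"] by (intro measure_completion) (simp add: borel_compact)
  ultimately show ?thesis by simp
qed

section \<open>Projections along a vector\<close>

lemma linear_proj_perp: "linear (proj_perp u)"
  unfolding proj_perp_def
  by (rule linearI) (simp_all add: inner_add_left add_divide_distrib algebra_simps)

lemma proj_perp_eq_0_iff: "proj_perp u v = 0 \<longleftrightarrow> (\<exists>c. v = c *\<^sub>R u)"
  by (cases "u = 0") (auto simp: proj_perp_def)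

text \<open>Injectivity of \<open>x\<close> lets weights on points be read as weights on
  indices.\<close>

lemma rel_interior_convex_hull_range:
  fixes x :: "'n::finite \<Rightarrow> 'a::euclidean_space"
  assumes "inj x" "\<not> affine_dependent (range x)"
  shows "rel_interior (convex hull (range x))
       = {\<Sum>i\<in>UNIV. l i *\<^sub>R x i | l. (\<forall>i. 0 < l i) \<and> sum l UNIV = 1}"
proof -
  have 1: "\<exists>l. y = (\<Sum>i\<in>UNIV. l i *\<^sub>R x i) \<and> (\<forall>i. 0 < l i) \<and> sum l UNIV = 1"
    if "\<forall>v\<in>range x. 0 < u v" "sum u (range x) = 1" "(\<Sum>v\<in>range x. u v *\<^sub>R v) = y" for u y
    using that by (intro exI[of _ "u \<circ> x"]) (simp add: sum.reindex[OF assms(1)] o_def)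
  have 2: "\<exists>u. (\<forall>v\<in>range x. 0 < u v) \<and> sum u (range x) = 1 \<and> (\<Sum>v\<in>range x. u v *\<^sub>R v) = y"
    if "\<forall>i. 0 < l i" "sum l UNIV = 1" "(\<Sum>i\<in>UNIV. l i *\<^sub>R x i) = y" for l y
    using that assms(1)
    by (intro exI[of _ "l \<circ> inv x"]) (simp add: sum.reindex[OF assms(1)] o_def)
  show ?thesis
    unfolding rel_interior_convex_hull_explicit[OF assms(2)]
  proof (intro Collect_cong iffI; elim exE conjE)
  qed (blast intro: 1, blast intro: 2[OF _ _ sym])
qed

text \<open>A repeated point gives equal rows. An affine dependence has coefficients of sum 0, so it
  is also a linear dependence of the rows \<open>x i - a\<close>. Both contradict the nonzero
  determinant.\<close>

lemma affine_independent_rows: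
  fixes x :: "'n::finite \<Rightarrow> real ^ 'n"
  assumes "det_rows (\<lambda>i. x i - a) \<noteq> 0"
  shows "inj x" "\<not> affine_dependent (range x)"
proof -
  show inj: "inj x"
  proof (rule injI, rule ccontr)
    fix i j assume "x i = x j" "i \<noteq> j"
    with assms show False
      using det_rows_eq_0[of i j "\<lambda>i. x i - a"] by simp
  qed
  show "\<not> affine_dependent (range x)"
  proof
    assume "affine_dependent (range x)"
    then obtain u v where u: "sum u (range x) = 0" "v \<in> range x" "u v \<noteq> 0"
      "(\<Sum>v\<in>range x. u v *\<^sub>R v) = 0"
      by (auto simp: affine_dependent_explicit_finite)
    obtain j where j: "v = x j" using u(2) by blast
    define c where "c = u \<circ> x"
    have c: "sum c UNIV = 0" "(\<Sum>i\<in>UNIV. c i *\<^sub>R x i) = 0" "c j \<noteq> 0"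
      using u j by (simp_all add: c_def sum.reindex[OF inj] o_def)
    have "(\<Sum>i\<in>UNIV. c i *\<^sub>R (x i - a)) = 0"
      using c by (simp add: scaleR_diff_right sum_subtractf flip: scaleR_sum_left)
    then have "det_rows ((\<lambda>i. x i - a)(j := 0)) = c j * det_rows (\<lambda>i. x i - a)"
      using det_rows_upd_combination[of "\<lambda>i. x i - a" j c] by simp
    moreover have "det_rows ((\<lambda>i. x i - a)(j := 0)) = 0"
      using linear_0[OF linear_det_rows_upd] .
    ultimately show False using c assms by simp
  qed
qed

text \<open>With \<open>y\<^sub>i = x\<^sub>i - u\<close>, a convex combination of the \<open>x\<^sub>i\<close> with weights \<open>l\<^sub>i\<close> equals \<open>c u\<close> iff
  \<open>\<Sum>\<^sub>i l\<^sub>i y\<^sub>i = (c - 1) u\<close>. Working with the \<open>y\<^sub>i\<close> covers the case that the \<open>x\<^sub>i\<close> are linearly dependent.\<close>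

lemma zero_in_rel_interior_proj_perp_iff:
  fixes x :: "'n::finite \<Rightarrow> real ^ 'n"
  assumes E: "det_rows (\<lambda>i. x i - u) \<noteq> 0"
  shows "0 \<in> rel_interior (convex hull (range (\<lambda>i. proj_perp u (x i)))) \<longleftrightarrow>
    (\<forall>j. 0 < det_rows (x(j := u))) \<or> (\<forall>j. det_rows (x(j := u)) < 0)" (is "?L \<longleftrightarrow> ?R")
proof -
  let ?E = "det_rows (\<lambda>i. x i - u)" and ?D = "\<lambda>j. det_rows (x(j := u))"
  have "range (\<lambda>i. proj_perp u (x i)) = proj_perp u ` range x"
    by auto
  then have "rel_interior (convex hull (range (\<lambda>i. proj_perp u (x i))))
      = proj_perp u ` rel_interior (convex hull (range x))"
    by (simp add: rel_interior_convex_linear_image linear_proj_perp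
        flip: convex_hull_linear_image[OF linear_proj_perp])
  \<comment> \<open>The kernel of the projection is the span of \<open>u\<close>.\<close>
  also have "0 \<in> \<dots> \<longleftrightarrow> (\<exists>v\<in>rel_interior (convex hull (range x)). \<exists>c. v = c *\<^sub>R u)"
    by (auto simp: image_iff proj_perp_eq_0_iff[symmetric] eq_commute[of 0])
  also have "\<dots> \<longleftrightarrow> (\<exists>l c. (\<forall>i. 0 < l i) \<and> sum l UNIV = 1 \<and> (\<Sum>i\<in>UNIV. l i *\<^sub>R x i) = c *\<^sub>R u)"
    unfolding rel_interior_convex_hull_range[OF affine_independent_rows[OF E]]
    by (auto, metis)
  finally have L: "?L \<longleftrightarrow> \<dots>" .
  have comb: "(\<Sum>i\<in>UNIV. l i *\<^sub>R (x i - u)) = (\<Sum>i\<in>UNIV. l i *\<^sub>R x i) - u" if "sum l UNIV = 1" for l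
    using that by (simp add: scaleR_diff_right sum_subtractf flip: scaleR_sum_left)
  show ?thesis
  proof
    assume ?L
    then obtain l c where l: "\<And>i. 0 < l i" "sum l UNIV = 1" "(\<Sum>i\<in>UNIV. l i *\<^sub>R x i) = c *\<^sub>R u"
      using L by blast
    have "(\<Sum>i\<in>UNIV. l i *\<^sub>R (x i - u)) = (c - 1) *\<^sub>R u"
      using comb[OF l(2)] l(3) by (simp add: algebra_simps)
    \<comment> \<open>Put either side of the equation into row \<open>j\<close> of the matrix with
      rows \<open>x i - u\<close>.\<close>
    then have D: "(c - 1) * ?D j = l j * ?E" for j
      using det_rows_upd_combination[of "\<lambda>i. x i - u" j l]
      by (simp add: det_rows_upd_scale det_rows_diff_upd)
    \<comment> \<open>\<open>c = 1\<close> would force \<open>l j * ?E = 0\<close>, although both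
      factors are nonzero. Hence every \<open>?D j\<close> is a positive multiple of
      \<open>?E / (c - 1)\<close>.\<close>
    have c: "c \<noteq> 1"
      using D[of undefined] l(1)[of undefined] E by auto
    have "?D j = l j * (?E / (c - 1))" for j
      using D[of j] c by (simp add: field_simps)
    then show ?R
      using E c l(1) by (cases "?E / (c - 1) > 0") (auto simp: zero_less_mult_iff mult_less_0_iff zero_less_divide_iff divide_less_0_iff)
  next
    assume R: ?R
    \<comment> \<open>The determinants, normalised to sum 1, serve as weights: Cramer's rule for the
      rows \<open>x j - u\<close> turns the weighted sum into a multiple of
      \<open>u\<close>.\<close>
    define s where "s = sum ?D UNIV"
    have s: "(\<forall>j. 0 < ?D j) \<and> 0 < s \<or> (\<forall>j. ?D j < 0) \<and> s < 0"
      using R sum_pos[of UNIV ?D] sum_pos[of UNIV "\<lambda>j. - ?D j"]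
      unfolding s_def by (auto simp: sum_negf)
    define l where "l j = ?D j / s" for j
    have l: "0 < l j" for j
      using s by (auto simp: l_def zero_less_divide_iff)
    have sl: "sum l UNIV = 1"
      unfolding l_def sum_divide_distrib[symmetric] s_def[symmetric] using s by auto
    have "(\<Sum>j\<in>UNIV. l j *\<^sub>R (x j - u)) = (1 / s) *\<^sub>R (\<Sum>j\<in>UNIV. ?D j *\<^sub>R (x j - u))"
      by (simp add: l_def scaleR_sum_right)
    also have "(\<Sum>j\<in>UNIV. ?D j *\<^sub>R (x j - u)) = ?E *\<^sub>R u"
      using cramer_rows[OF E, of u] by (simp add: det_rows_diff_upd)
    finally have "(\<Sum>i\<in>UNIV. l i *\<^sub>R x i) = (?E / s + 1) *\<^sub>R u"
      using comb[OF sl] by (simp add: algebra_simps)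
    then show ?L
      using L l sl by blast
  qed
qed

section \<open>Moments of the uniform distribution on the sphere\<close>

text \<open>The half-lines \<open>{..r}\<close> form an intersection-stable generator of the Borel
  sets, so the distribution function determines \<open>N\<close>; its derivative is the
  density.\<close>

lemma distr_power_law:
  fixes N :: "real measure"
  assumes sets: "sets N = sets borel" and p: "0 < p" and C: "C \<noteq> \<infinity>"
    and em: "\<And>r. 0 \<le> r \<Longrightarrow> emeasure N {..r} = C * ennreal (r powr p)"
  shows "N = density lborel (\<lambda>t. C * ennreal (indicator {0..} t * (p * t powr (p - 1))))" (is "N = ?D")
proof (rule measure_eqI_generator_eq[where E="range atMost" and \<Omega>=UNIV and A="\<lambda>n. {..real n}"])
  show "Int_stable (range atMost :: real set set)"
    by (auto simp: Int_stable_def)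
  have borel: "sets borel = sigma_sets UNIV (range atMost :: real set set)"
    by (simp add: borel_eq_atMost)
  then show "sets N = sigma_sets UNIV (range atMost)" "sets ?D = sigma_sets UNIV (range atMost)"
    using sets by simp_all
  have D: "emeasure ?D {..r} = C * ennreal (r powr p)" if "0 \<le> r" for r
  proof -
    have hi: "((\<lambda>t. p * t powr (p - 1)) has_integral r powr p) {0..r}"
      using has_integral_mult_right[OF has_integral_powr_from_0[of "p - 1" r], of p] p that by simp
    have "emeasure ?D {..r} = (\<integral>\<^sup>+t. C * (ennreal (indicator {0..r} t * (p * t powr (p - 1)))) \<partial>lborel)"
      by (subst emeasure_density) (auto intro!: nn_integral_cong split: split_indicator)
    also have "\<dots> = C * ennreal (r powr p)"
      using nn_integral_has_integral_lebesgue[OF _ hi] p by (subst nn_integral_cmult) auto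
    finally show ?thesis .
  qed
  fix X :: "real set" assume "X \<in> range atMost"
  then obtain r where X: "X = {..r}" by auto
  show "emeasure N X = emeasure ?D X"
  proof (cases "0 \<le> r")
    case True
    then show ?thesis using em D X by simp
  next
    case False
    \<comment> \<open>\<open>{..0}\<close> has mass \<open>C * ennreal (0 powr p) = 0\<close>, so
      half-lines further left are null for both measures.\<close>
    then have sub: "X \<subseteq> {..0}" unfolding X by simp
    have "emeasure N X \<le> emeasure N {..0}" "emeasure ?D X \<le> emeasure ?D {..0}"
      by (rule emeasure_mono[OF sub], simp add: sets)+
    then show ?thesis
      unfolding em[OF order_refl] D[OF order_refl] by simp
  qed
next
  show "(\<Union>i. {..real i}) = UNIV"
    by (auto intro: real_arch_simple)
  show "emeasure N {..real i} \<noteq> \<infinity>" for i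
    using em[of "real i"] C by (simp add: ennreal_mult_eq_top_iff)
  show "(range atMost :: real set set) \<subseteq> Pow UNIV" "range (\<lambda>n. {..real n}) \<subseteq> range atMost"
    by auto
qed

text \<open>The power law fixes the density of the distribution of \<open>q\<close>, and the factor
  \<open>t powr s * exp (- t)\<close> turns the integral into Euler's integral for
  \<open>Gamma (p + s)\<close>. \<open>hq\<close> speaks of \<open>t > 0\<close> only: since
  \<open>0 powr 0 = 0\<close>, the function \<open>exp (- t)\<close> would otherwise be excluded for
  \<open>s = 0\<close>.\<close>

lemma nn_integral_power_law_Gamma:
  assumes q[measurable]: "q \<in> borel_measurable M" and p: "0 < p" "0 < p + s" and C: "C \<noteq> \<infinity>"
    and em: "\<And>r. 0 \<le> r \<Longrightarrow> emeasure M {x\<in>space M. q x \<le> r} = C * ennreal (r powr p)"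
    and h[measurable]: "h \<in> borel_measurable borel"
    and hq: "\<And>t. 0 < t \<Longrightarrow> h t = t powr s * exp (- t)"
  shows "(\<integral>\<^sup>+x. ennreal (h (q x)) \<partial>M) = C * ennreal (p * Gamma (p + s))"
proof -
  have "(\<integral>\<^sup>+x. ennreal (h (q x)) \<partial>M) = (\<integral>\<^sup>+t. ennreal (h t) \<partial>distr M borel q)"
    by (subst nn_integral_distr) auto
  also have "distr M borel q = density lborel (\<lambda>t. C * ennreal (indicator {0..} t * (p * t powr (p - 1))))"
  proof (rule distr_power_law)
    fix r :: real assume "0 \<le> r"
    then show "emeasure (distr M borel q) {..r} = C * ennreal (r powr p)"
      using em[of r] by (subst emeasure_distr) (auto simp: vimage_def Int_def conj_commute)
  qed (use p C in auto)
  also have "(\<integral>\<^sup>+t. ennreal (h t) \<partial>\<dots>)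
      = (\<integral>\<^sup>+t. C * ennreal (indicator {0..} t * (p * t powr (p - 1))) * ennreal (h t) \<partial>lborel)"
    by (subst nn_integral_density) auto
  also have "\<dots> = (\<integral>\<^sup>+t. C * (ennreal p * ennreal (indicator {0..} t * t powr (p + s - 1) / exp t)) \<partial>lborel)"
  proof (rule nn_integral_cong_AE)
    have "AE t::real in lborel. t \<noteq> 0" by (rule AE_lborel_singleton)
    then show "AE t in lborel. C * ennreal (indicator {0..} t * (p * t powr (p - 1))) * ennreal (h t)
      = C * (ennreal p * ennreal (indicator {0..} t * t powr (p + s - 1) / exp t))"
    proof eventually_elim
      case (elim t)
      show ?case
      proof (cases "0 < t")
        case True
        have "t powr (p + s - 1) = t powr (p - 1) * t powr s"
          by (simp add: powr_add[symmetric] algebra_simps)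
        then show ?thesis
          using True p by (simp add: hq ennreal_mult'[symmetric] mult.assoc exp_minus divide_inverse)
      qed (use elim in auto)
    qed
  qed
  also have "\<dots> = C * (ennreal p * ennreal (Gamma (p + s)))"
    by (simp add: nn_integral_cmult Gamma_conv_nn_integral_real[OF p(2)])
  finally show ?thesis
    using p by (simp add: ennreal_mult)
qed

lemma nn_integral_lborel_scale:
  fixes f :: "'a::euclidean_space \<Rightarrow> ennreal"
  assumes A: "A \<subseteq> Basis" and c: "0 < c" and f[measurable]: "f \<in> borel_measurable borel"
  shows "integral\<^sup>N lborel f = ennreal (c ^ card A) *
    (\<integral>\<^sup>+x. f (\<Sum>j\<in>Basis. ((if j \<in> A then c else 1) * (x \<bullet> j)) *\<^sub>R j) \<partial>lborel)"
proof -
  let ?c = "\<lambda>j. if j \<in> A then c else 1"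
  let ?T = "\<lambda>x::'a. 0 + (\<Sum>j\<in>Basis. (?c j * (x \<bullet> j)) *\<^sub>R j)"
  have [measurable]: "?T \<in> borel_measurable borel" by simp
  have "(\<Prod>j\<in>Basis. \<bar>?c j\<bar>) = (\<Prod>j\<in>Basis. if j \<in> A then c else 1)"
    using c by (intro prod.cong) auto
  also have "\<dots> = c ^ card A"
    using A by (subst prod.inter_restrict[symmetric]) (auto simp: Int_absorb1)
  finally have prod: "(\<Prod>j\<in>Basis. \<bar>?c j\<bar>) = c ^ card A" .
  have "lborel = density (distr lborel borel ?T) (\<lambda>_. (\<Prod>j\<in>Basis. \<bar>?c j\<bar>))"
    using c by (intro lborel_affine_euclidean) auto
  then have "integral\<^sup>N lborel f = integral\<^sup>N (density (distr lborel borel ?T) (\<lambda>_. ennreal (c ^ card A))) f"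
    unfolding prod by simp
  also have "\<dots> = ennreal (c ^ card A) * (\<integral>\<^sup>+x. f (?T x) \<partial>lborel)"
    by (simp add: nn_integral_density nn_integral_cmult nn_integral_distr)
  finally show ?thesis by simp
qed

lemma powr_half_power: "0 < r \<Longrightarrow> sqrt r ^ k = r powr (real k / 2)"
  by (simp add: powr_half_sqrt[symmetric] powr_power)

section \<open>Gaussian integrals over groups of coordinates\<close>

text \<open>For \<open>A \<subseteq> Basis\<close>, the squared length of the orthogonal projection
  to the span of \<open>A\<close>.\<close>

definition coord_sq :: "'a::euclidean_space set \<Rightarrow> 'a \<Rightarrow> real" where
  "coord_sq A x = (\<Sum>i\<in>A. (x \<bullet> i)\<^sup>2)"

lemma coord_sq_measurable [measurable]: "coord_sq A \<in> borel_measurable borel"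
  unfolding coord_sq_def by measurable

lemma coord_sq_nonneg: "0 \<le> coord_sq A x"
  by (simp add: coord_sq_def sum_nonneg)

lemma coord_sq_Basis: "coord_sq Basis x = (norm x)\<^sup>2"
  unfolding coord_sq_def power2_norm_eq_inner euclidean_inner[of x x] by (simp add: power2_eq_square)

lemma coord_sq_split: "A \<subseteq> Basis \<Longrightarrow> (norm x)\<^sup>2 = coord_sq A x + coord_sq (Basis - A) x"
  unfolding coord_sq_Basis[symmetric] by (simp add: coord_sq_def sum.subset_diff add.commute)

lemma coord_sq_scale:
  assumes "A \<subseteq> Basis" "B \<subseteq> Basis"
  shows "coord_sq B (\<Sum>j\<in>Basis. ((if j \<in> A then c else 1) * (x \<bullet> j)) *\<^sub>R j)
    = c\<^sup>2 * coord_sq (A \<inter> B) x + coord_sq (B - A) x"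
proof -
  have "coord_sq B (\<Sum>j\<in>Basis. ((if j \<in> A then c else 1) * (x \<bullet> j)) *\<^sub>R j)
      = (\<Sum>i\<in>B. if i \<in> A then c\<^sup>2 * (x \<bullet> i)\<^sup>2 else (x \<bullet> i)\<^sup>2)"
    unfolding coord_sq_def using assms(2)
    by (intro sum.cong refl) (auto simp: inner_sum_left_Basis power_mult_distrib)
  also have "\<dots> = c\<^sup>2 * coord_sq (A \<inter> B) x + coord_sq (B - A) x"
    using finite_subset[OF assms(2)]
    by (simp add: sum.If_cases coord_sq_def sum_distrib_left Int_commute Diff_eq)
  finally show ?thesis .
qed

lemma AE_lborel_hyperplane:
  fixes a :: "'a::euclidean_space"
  assumes "a \<noteq> 0"
  shows "AE x in lborel. a \<bullet> x \<noteq> 0"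
proof -
  have "negligible {x. a \<bullet> x = 0}"
    using assms by (intro negligible_hyperplane) simp
  then have "{x. a \<bullet> x = 0} \<in> null_sets lborel"
    unfolding negligible_iff_null_sets
    by (subst (asm) null_sets_completion_iff) (simp_all add: closed_hyperplane borel_closed)
  then show ?thesis
    by (rule AE_I') simp
qed

lemma AE_coord_sq_pos:
  assumes "A \<subseteq> Basis" "A \<noteq> {}"
  shows "AE x in lborel. \<not> coord_sq A x \<le> 0"
proof -
  obtain i where i: "i \<in> A" using assms by blast
  then have "i \<noteq> 0" using assms(1) nonzero_Basis by blast
  from AE_lborel_hyperplane[OF this] show ?thesis
  proof eventually_elim
    case (elim x)
    then have "0 < (x \<bullet> i)\<^sup>2" by (simp add: inner_commute)
    also have "\<dots> \<le> coord_sq A x"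
      unfolding coord_sq_def using i finite_subset[OF assms(1)] by (intro member_le_sum) auto
    finally show ?case by simp
  qed
qed

text \<open>The value of the Gaussian integral is never needed, only that it is positive and finite.\<close>

definition gauss_mass :: "'a::euclidean_space itself \<Rightarrow> ennreal" where
  "gauss_mass _ = (\<integral>\<^sup>+(x::'a). ennreal (exp (- (norm x)\<^sup>2)) \<partial>lborel)"

text \<open>Multiplying only the coordinates in \<open>A\<close> by \<open>sqrt r\<close> preserves
  the weight, which depends on the other coordinates; the Jacobian is the power of
  \<open>r\<close>.\<close>

lemma emeasure_coord_sq_le:
  fixes A :: "'a::euclidean_space set"
  assumes A: "A \<subseteq> Basis" "A \<noteq> {}" and r: "0 \<le> r"
  shows "emeasure (density lborel (\<lambda>x. ennreal (exp (- coord_sq (Basis - A) x)))) {x. coord_sq A x \<le> r}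
    = emeasure (density lborel (\<lambda>x. ennreal (exp (- coord_sq (Basis - A) x)))) {x. coord_sq A x \<le> 1}
        * ennreal (r powr (card A / 2))"
proof -
  let ?w = "\<lambda>x::'a. ennreal (exp (- coord_sq (Basis - A) x))"
  have em: "emeasure (density lborel ?w) {x. coord_sq A x \<le> s} = (\<integral>\<^sup>+x. ?w x * indicator {x. coord_sq A x \<le> s} x \<partial>lborel)" for s
    by (rule emeasure_density) measurable
  show ?thesis
  proof (cases "r = 0")
    \<comment> \<open>Scaling by 0 is not invertible, but here the set lies in a hyperplane and is
      null.\<close>
    case True
    have "(\<integral>\<^sup>+x. ?w x * indicator {x. coord_sq A x \<le> 0} x \<partial>lborel) = (\<integral>\<^sup>+(x::'a). 0 \<partial>lborel)"
      using AE_coord_sq_pos[OF A] by (intro nn_integral_cong_AE) (auto split: split_indicator)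
    then show ?thesis using True em[of 0] by simp
  next
    case False
    then have r: "0 < r" using r by simp
    have *: "A \<inter> (Basis - A) = {}" "Basis - A - A = Basis - A" "A - A = {}" by auto
    have "emeasure (density lborel ?w) {x. coord_sq A x \<le> r}
        = ennreal (sqrt r ^ card A) * (\<integral>\<^sup>+x. ?w x * indicator {x. r * coord_sq A x \<le> r} x \<partial>lborel)"
      unfolding em using r A(1)
      by (subst nn_integral_lborel_scale[of A "sqrt r"])
         (auto simp: coord_sq_scale * coord_sq_def[of "{}"] indicator_def)
    also have "{x. r * coord_sq A x \<le> r} = {x. coord_sq A x \<le> 1}"
      using r by auto
    finally show ?thesis
      using r unfolding em[of 1] by (simp add: powr_half_power mult.commute)
  qed
qed

text \<open>The Gaussian factor of the coordinates outside \<open>A\<close> becomes the density of a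
  measure under which \<open>coord_sq A\<close> obeys a power law; the other factor yields the Gamma
  integral. Finiteness of \<open>C\<close> is assumed because for general \<open>A\<close> it is
  derived from that of \<open>gauss_mass\<close>, which rests on the case
  \<open>A = Basis\<close>.\<close>

lemma nn_integral_coord_sq_gauss:
  fixes A :: "'a::euclidean_space set"
  assumes A: "A \<subseteq> Basis" "A \<noteq> {}"
    and C: "C = emeasure (density lborel (\<lambda>x. ennreal (exp (- coord_sq (Basis - A) x)))) {x. coord_sq A x \<le> 1}"
       "C \<noteq> \<infinity>"
    and h[measurable]: "h \<in> borel_measurable borel" and s: "0 \<le> s"
    and hq: "\<And>t. 0 < t \<Longrightarrow> h t = t powr s" "\<And>t. 0 \<le> h t"
  shows "(\<integral>\<^sup>+(x::'a). ennreal (h (coord_sq A x) * exp (- (norm x)\<^sup>2)) \<partial>lborel)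
    = C * ennreal (card A / 2 * Gamma (card A / 2 + s))"
proof -
  let ?M = "density lborel (\<lambda>x::'a. ennreal (exp (- coord_sq (Basis - A) x)))"
  have k: "0 < card A"
    using A finite_subset[OF A(1)] by (simp add: card_gt_0_iff)
  have "(\<integral>\<^sup>+x. ennreal (h (coord_sq A x) * exp (- coord_sq A x)) \<partial>?M) = C * ennreal (card A / 2 * Gamma (card A / 2 + s))"
  proof (rule nn_integral_power_law_Gamma[where q="coord_sq A" and s=s and h="\<lambda>t. h t * exp (- t)"])
    fix r :: real assume "0 \<le> r"
    then show "emeasure ?M {x \<in> space ?M. coord_sq A x \<le> r} = C * ennreal (r powr (card A / 2))"
      using emeasure_coord_sq_le[OF A, of r] by (simp add: C(1))
  next
    show "h t * exp (- t) = t powr s * exp (- t)" if "0 < t" for t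
      using hq(1)[OF that] by simp
    show "0 < real (card A) / 2" "0 < real (card A) / 2 + s"
      using k s by (auto intro: add_pos_nonneg)
    show "C \<noteq> \<infinity>" by (rule C)
  qed measurable
  also have "(\<integral>\<^sup>+x. ennreal (h (coord_sq A x) * exp (- coord_sq A x)) \<partial>?M)
      = (\<integral>\<^sup>+x. ennreal (exp (- coord_sq (Basis - A) x)) * ennreal (h (coord_sq A x) * exp (- coord_sq A x)) \<partial>lborel)"
    by (rule nn_integral_density) measurable
  also have "\<dots> = (\<integral>\<^sup>+(x::'a). ennreal (h (coord_sq A x) * exp (- (norm x)\<^sup>2)) \<partial>lborel)"
  proof (rule nn_integral_cong)
    fix x :: 'a
    have "exp (- (norm x)\<^sup>2) = exp (- coord_sq (Basis - A) x) * exp (- coord_sq A x)"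
      unfolding exp_add[symmetric] coord_sq_split[OF A(1)] by simp
    then have "h (coord_sq A x) * exp (- (norm x)\<^sup>2) = exp (- coord_sq (Basis - A) x) * (h (coord_sq A x) * exp (- coord_sq A x))"
      by simp
    then show "ennreal (exp (- coord_sq (Basis - A) x)) * ennreal (h (coord_sq A x) * exp (- coord_sq A x))
      = ennreal (h (coord_sq A x) * exp (- (norm x)\<^sup>2))"
      by (simp only: ennreal_mult'[symmetric] exp_ge_zero)
  qed
  finally show ?thesis .
qed

text \<open>For \<open>A = Basis\<close> the weight is 1 and the constant \<open>C\<close> is the
  volume of the unit ball.\<close>

lemma gauss_mass_conv_ball:
  "gauss_mass TYPE('a::euclidean_space)
    = emeasure lborel (cball (0::'a) 1) * ennreal (DIM('a) / 2 * Gamma (DIM('a) / 2))"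
proof -
  have "{x::'a. (norm x)\<^sup>2 \<le> 1} = cball 0 1"
    by (auto simp: power_le_one_iff abs_square_le_1)
  then have "emeasure (density lborel (\<lambda>x::'a. ennreal (exp (- coord_sq (Basis - Basis) x)))) {x. coord_sq Basis x \<le> 1}
      = emeasure lborel (cball (0::'a) 1)"
    by (simp add: coord_sq_Basis coord_sq_def[of "{}"] emeasure_density)
  then show ?thesis
    using nn_integral_coord_sq_gauss[of "Basis :: 'a set" "emeasure lborel (cball (0::'a) 1)" "\<lambda>_. 1" 0]
      emeasure_unit_cball_finite[where 'a='a]
    by (simp add: gauss_mass_def)
qed

lemma gauss_mass_finite: "gauss_mass TYPE('a::euclidean_space) \<noteq> \<infinity>"
  and gauss_mass_nonzero: "gauss_mass TYPE('a::euclidean_space) \<noteq> 0"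
proof -
  obtain g where "0 < g" "gauss_mass TYPE('a) = emeasure lborel (cball (0::'a) 1) * ennreal g"
  proof (rule that[OF _ gauss_mass_conv_ball])
    show "0 < DIM('a) / 2 * Gamma (DIM('a) / 2)"
      by (intro mult_pos_pos Gamma_real_pos) simp_all
  qed
  then show "gauss_mass TYPE('a) \<noteq> \<infinity>" "gauss_mass TYPE('a) \<noteq> 0"
    using emeasure_unit_cball_finite[where 'a='a] emeasure_unit_cball_nonzero[where 'a='a]
    by (simp_all add: ennreal_mult_eq_top_iff)
qed

text \<open>Relates the moments for \<open>s = 1/2\<close> and \<open>s = 0\<close>, so that their
  common constant can be absorbed in \<open>gauss_mass\<close>.\<close>

lemma Gamma_half_shift:
  assumes "0 < x"
  shows "c * ennreal (x * Gamma (x + 1/2)) = c * ennreal (x * Gamma x) * ennreal (Gamma (x + 1/2) / Gamma x)"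
proof -
  have pos: "0 < Gamma x" "0 < Gamma (x + 1/2)"
    using assms by (auto intro!: Gamma_real_pos)
  then have eq: "x * Gamma (x + 1/2) = x * Gamma x * (Gamma (x + 1/2) / Gamma x)"
    by (simp add: field_simps)
  show ?thesis
    unfolding eq using assms pos
    by (subst ennreal_mult) (auto simp only: mult.assoc intro!: mult_pos_pos divide_pos_pos less_imp_le)
qed

text \<open>This integral and \<open>gauss_mass\<close> are multiples of the same unknown
  \<open>C\<close>, for \<open>s = 1/2\<close> and \<open>s = 0\<close>; their ratio is free of
  \<open>C\<close>.\<close>

lemma gauss_coord_norm:
  fixes A :: "'a::euclidean_space set"
  assumes A: "A \<subseteq> Basis" "A \<noteq> {}"
  shows "(\<integral>\<^sup>+(x::'a). ennreal (sqrt (coord_sq A x) * exp (- (norm x)\<^sup>2)) \<partial>lborel)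
    = gauss_mass TYPE('a) * ennreal (Gamma ((real (card A) + 1) / 2) / Gamma (card A / 2))"
proof -
  define C where "C = emeasure (density lborel (\<lambda>x::'a. ennreal (exp (- coord_sq (Basis - A) x)))) {x. coord_sq A x \<le> 1}"
  have "C = (\<integral>\<^sup>+(x::'a). ennreal (exp (- coord_sq (Basis - A) x)) * indicator {x. coord_sq A x \<le> 1} x \<partial>lborel)"
    unfolding C_def by (rule emeasure_density) measurable
  \<comment> \<open>Where \<open>coord_sq A x \<le> 1\<close>, the missing factor
    \<open>exp (- coord_sq A x)\<close> is at least \<open>exp (- 1)\<close>.\<close>
  also have "\<dots> \<le> (\<integral>\<^sup>+(x::'a). ennreal (exp 1) * ennreal (exp (- (norm x)\<^sup>2)) \<partial>lborel)"
    by (intro nn_integral_mono)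
       (auto simp: coord_sq_split[OF A(1)] ennreal_mult[symmetric] exp_add[symmetric] split: split_indicator)
  also have "\<dots> = ennreal (exp 1) * gauss_mass TYPE('a)"
    by (simp add: gauss_mass_def nn_integral_cmult)
  also have "\<dots> < \<infinity>"
    using gauss_mass_finite[where 'a='a] by (simp add: ennreal_mult_less_top less_top)
  finally have fin: "C \<noteq> \<infinity>" by simp
  have k: "0 < card A"
    using A finite_subset[OF A(1)] by (simp add: card_gt_0_iff)
  have "gauss_mass TYPE('a) = C * ennreal (card A / 2 * Gamma (card A / 2))"
    using nn_integral_coord_sq_gauss[OF A C_def fin, of "\<lambda>_. 1" 0] by (simp add: gauss_mass_def)
  \<comment> \<open>The absolute value keeps \<open>h\<close> nonnegative on the whole line, since
    \<open>sqrt\<close> is negative at negative arguments.\<close>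
  moreover have "(\<integral>\<^sup>+(x::'a). ennreal (sqrt (coord_sq A x) * exp (- (norm x)\<^sup>2)) \<partial>lborel)
      = C * ennreal (card A / 2 * Gamma (card A / 2 + 1 / 2))"
    by (rule nn_integral_coord_sq_gauss[OF A C_def fin, of "\<lambda>t. sqrt \<bar>t\<bar>" "1/2", simplified coord_sq_nonneg abs_of_nonneg])
       (auto simp: powr_half_sqrt)
  moreover have "(real (card A) + 1) / 2 = card A / 2 + 1 / 2"
    by (simp add: add_divide_distrib)
  ultimately show ?thesis
    using Gamma_half_shift[of "card A / 2" C] k by (simp only: of_nat_0_less_iff zero_less_divide_iff) simp
qed

section \<open>Polar coordinates and projections of a uniform point\<close>

lemma nn_integral_uniform_sphere:
  fixes f :: "'a::euclidean_space \<Rightarrow> ennreal"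
  assumes [measurable]: "f \<in> borel_measurable borel"
  shows "(\<integral>\<^sup>+x. f (sgn x) * indicator (cball 0 1) x \<partial>lborel)
    = emeasure lborel (cball (0::'a) 1) * integral\<^sup>N uniform_sphere f"
proof -
  have "integral\<^sup>N uniform_sphere f = (\<integral>\<^sup>+x. f (sgn x) * indicator (cball 0 1) x \<partial>lborel) / emeasure lborel (cball (0::'a) 1)"
    unfolding uniform_sphere_def by (subst nn_integral_distr) (auto simp: nn_integral_uniform_measure)
  then show ?thesis
    using emeasure_unit_cball_finite[where 'a='a] emeasure_unit_cball_nonzero[where 'a='a]
    by (simp add: ennreal_times_divide mult.commute[of "emeasure _ _"] ennreal_mult_divide_eq)
qed

text \<open>By scaling, the measure with density \<open>f \<circ> sgn\<close> gives mass proportional to \<open>r powr (DIM('a) / 2)\<close> to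
  the ball \<open>(norm x)\<^sup>2 \<le> r\<close>, which determines the distribution of the radius under it.\<close>

lemma gauss_polar:
  fixes f :: "'a::euclidean_space \<Rightarrow> ennreal"
  assumes f[measurable]: "f \<in> borel_measurable borel" and fin: "integral\<^sup>N uniform_sphere f \<noteq> \<infinity>"
  shows "(\<integral>\<^sup>+x. f (sgn x) * ennreal (norm x * exp (- (norm x)\<^sup>2)) \<partial>lborel)
    = integral\<^sup>N uniform_sphere f * gauss_mass TYPE('a) * ennreal (Gamma ((real DIM('a) + 1) / 2) / Gamma (DIM('a) / 2))"
proof -
  let ?M = "density lborel (\<lambda>x. f (sgn x))"
  define C where "C = emeasure lborel (cball (0::'a) 1) * integral\<^sup>N uniform_sphere f"
  have C: "C \<noteq> \<infinity>"
    using fin emeasure_unit_cball_finite[where 'a='a] by (auto simp: C_def ennreal_mult_eq_top_iff)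
  have em: "emeasure ?M {x. (norm x)\<^sup>2 \<le> r} = (\<integral>\<^sup>+x. f (sgn x) * indicator {x. (norm x)\<^sup>2 \<le> r} x \<partial>lborel)" for r
    by (rule emeasure_density) measurable
  have "(\<integral>\<^sup>+x. ennreal (sqrt \<bar>(norm x)\<^sup>2\<bar> * exp (- (norm x)\<^sup>2)) \<partial>?M) = C * ennreal (DIM('a) / 2 * Gamma (DIM('a) / 2 + 1 / 2))"
  proof (rule nn_integral_power_law_Gamma[where q="\<lambda>x. (norm x)\<^sup>2" and s="1/2" and h="\<lambda>t. sqrt \<bar>t\<bar> * exp (- t)"])
    fix r :: real assume r: "0 \<le> r"
    show "emeasure ?M {x \<in> space ?M. (norm x)\<^sup>2 \<le> r} = C * ennreal (r powr (DIM('a) / 2))"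
    proof (cases "r = 0")
      case True
      have "AE x::'a in lborel. x \<noteq> 0" by (rule AE_lborel_singleton)
      then have "(\<integral>\<^sup>+x. f (sgn x) * indicator {x. (norm x)\<^sup>2 \<le> 0} x \<partial>lborel) = (\<integral>\<^sup>+(x::'a). 0 \<partial>lborel)"
      proof (intro nn_integral_cong_AE, eventually_elim)
        case (elim x)
        then show ?case by simp
      qed
      then show ?thesis using em[of 0] True by simp
    next
      case False
      then have r: "0 < r" using r by simp
      \<comment> \<open>A dilation of the whole space preserves \<open>sgn x\<close>, hence the
        density.\<close>
      have T: "(\<Sum>j\<in>Basis. (sqrt r * (x \<bullet> j)) *\<^sub>R j) = sqrt r *\<^sub>R x" for x :: 'a
        by (simp add: euclidean_representation flip: scaleR_scaleR scaleR_sum_right)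
      have "emeasure ?M {x. (norm x)\<^sup>2 \<le> r}
        = ennreal (sqrt r ^ DIM('a)) * (\<integral>\<^sup>+x. f (sgn x) * indicator {x. r * (norm x)\<^sup>2 \<le> r} x \<partial>lborel)"
        unfolding em using r
        by (subst nn_integral_lborel_scale[of Basis "sqrt r"])
           (auto simp: T sgn_scaleR power_mult_distrib indicator_def)
      also have "{x. r * (norm x)\<^sup>2 \<le> r} = cball (0::'a) 1"
        using r by (auto simp: abs_square_le_1)
      finally show ?thesis
        using r by (simp add: nn_integral_uniform_sphere C_def powr_half_power mult.commute)
    qed
  qed (use C in \<open>auto simp: powr_half_sqrt\<close>)
  also have "\<dots> = integral\<^sup>N uniform_sphere f * (emeasure lborel (cball (0::'a) 1) *
      ennreal (DIM('a) / 2 * Gamma (DIM('a) / 2 + 1 / 2)))"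
    by (simp add: C_def mult_ac)
  also have "\<dots> = integral\<^sup>N uniform_sphere f * gauss_mass TYPE('a) * ennreal (Gamma (DIM('a) / 2 + 1 / 2) / Gamma (DIM('a) / 2))"
    unfolding gauss_mass_conv_ball by (subst Gamma_half_shift) (simp_all add: mult_ac)
  also have "DIM('a) / 2 + 1 / 2 = (real DIM('a) + 1) / 2" by simp
  finally show ?thesis
    by (simp add: nn_integral_density)
qed

text \<open>The Gaussian integral of \<open>sqrt (coord_sq A x)\<close> is computed twice, by
  coordinates and in polar form. Homogeneity splits off the factor \<open>norm x\<close>, and
  \<open>gauss_mass\<close> cancels.\<close>

lemma uniform_sphere_coord_norm:
  fixes A :: "'a::euclidean_space set"
  assumes A: "A \<subseteq> Basis" "A \<noteq> {}"
  shows "(\<integral>\<^sup>+x. ennreal (sqrt (coord_sq A x)) \<partial>(uniform_sphere :: 'a measure))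
    = ennreal (Gamma ((real (card A) + 1) / 2) * Gamma (DIM('a) / 2) / (Gamma (card A / 2) * Gamma ((real DIM('a) + 1) / 2)))"
proof -
  interpret prob_space "uniform_sphere :: 'a measure" by (rule prob_space_uniform_sphere)
  let ?I = "\<integral>\<^sup>+x. ennreal (sqrt (coord_sq A x)) \<partial>(uniform_sphere :: 'a measure)"
  let ?a = "Gamma ((real (card A) + 1) / 2) / Gamma (card A / 2)"
  let ?b = "Gamma ((real DIM('a) + 1) / 2) / Gamma (DIM('a) / 2)"
  have k: "0 < card A"
    using A finite_subset[OF A(1)] by (simp add: card_gt_0_iff)
  \<comment> \<open>\<open>gauss_polar\<close> needs a finite mean; on the unit sphere a projection
    has length at most 1.\<close>
  have "?I \<le> (\<integral>\<^sup>+x. 1 \<partial>(uniform_sphere :: 'a measure))"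
  proof (rule nn_integral_mono_AE)
    show "AE x in (uniform_sphere :: 'a measure). ennreal (sqrt (coord_sq A x)) \<le> 1"
      using AE_uniform_sphere
    proof eventually_elim
      case (elim x)
      then have "coord_sq A x \<le> 1"
        using coord_sq_split[OF A(1), of x] coord_sq_nonneg[of "Basis - A" x] by simp
      then show ?case by simp
    qed
  qed
  then have fin: "?I \<noteq> \<infinity>"
    using emeasure_space_1 by (auto simp: top_unique)
  have "sqrt (coord_sq A (sgn x)) * norm x = sqrt (coord_sq A x)" for x :: 'a
  proof (cases "x = 0")
    case False
    have "coord_sq A (sgn x) = coord_sq A x / (norm x)\<^sup>2"
      by (simp add: coord_sq_def sgn_div_norm divide_inverse power_mult_distrib power_inverse
          sum_distrib_left mult.commute)
    then show ?thesis
      using False by (simp add: real_sqrt_divide)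
  qed (simp add: coord_sq_def)
  then have "(\<integral>\<^sup>+(x::'a). ennreal (sqrt (coord_sq A x) * exp (- (norm x)\<^sup>2)) \<partial>lborel)
      = (\<integral>\<^sup>+(x::'a). ennreal (sqrt (coord_sq A (sgn x))) * ennreal (norm x * exp (- (norm x)\<^sup>2)) \<partial>lborel)"
    by (simp add: ennreal_mult[symmetric] coord_sq_nonneg mult.assoc[symmetric])
  then have "gauss_mass TYPE('a) * ennreal ?a = ?I * gauss_mass TYPE('a) * ennreal ?b"
    using gauss_polar[OF _ fin] gauss_coord_norm[OF A] by simp
  then have "gauss_mass TYPE('a) * ennreal ?a = gauss_mass TYPE('a) * (?I * ennreal ?b)"
    by (simp add: mult_ac)
  then have "ennreal ?a = ?I * ennreal ?b"
    using gauss_mass_finite[where 'a='a] gauss_mass_nonzero[where 'a='a]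
    by (simp add: ennreal_mult_cancel_left)
  moreover obtain r where r: "?I = ennreal r" "0 \<le> r"
    using fin by (cases ?I) auto
  moreover have "0 < ?a" "0 < ?b" using k by simp_all
  ultimately have "?a = r * ?b"
    by (simp add: ennreal_mult[symmetric])
  then have "r = ?a / ?b"
    using \<open>0 < ?b\<close> by (metis nonzero_mult_div_cancel_right less_irrefl)
  then show ?thesis
    unfolding r(1) by (simp only: divide_divide_times_eq)
qed

lemma AE_uniform_sphere_hyperplane:
  fixes a :: "'a::euclidean_space"
  assumes "a \<noteq> 0"
  shows "AE x in uniform_sphere. a \<bullet> x \<noteq> 0"
proof -
  note AE_lborel_hyperplane[OF assms]
  moreover have "AE x in lborel. x \<noteq> (0::'a)"
    by (rule AE_lborel_singleton)
  ultimately have "AE x in lborel. a \<bullet> sgn x \<noteq> 0"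
    by eventually_elim (simp add: sgn_div_norm)
  then have "AE x in uniform_measure lborel (cball 0 1). a \<bullet> sgn x \<noteq> 0"
    by (intro AE_uniform_measureI) (auto elim!: eventually_mono)
  then show ?thesis
    unfolding uniform_sphere_def by (subst AE_distr_iff) auto
qed

section \<open>Products of uniform distributions on the sphere\<close>

text \<open>Preimages of boxes are boxes, so the measures are compared factor by factor.\<close>

lemma distr_PiM_component:
  assumes I: "finite I" and M: "sigma_finite_measure M"
    and T: "\<And>i. T i \<in> measurable M M" "\<And>i. distr M M (T i) = M"
  shows "distr (PiM I (\<lambda>_. M)) (PiM I (\<lambda>_. M)) (\<lambda>x. \<lambda>i\<in>I. T i (x i)) = PiM I (\<lambda>_. M)"
proof -
  interpret product_sigma_finite "\<lambda>_. M"
    using M by (rule product_sigma_finite.intro)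
  let ?T = "\<lambda>x. \<lambda>i\<in>I. T i (x i)" and ?P = "PiM I (\<lambda>_. M)"
  have meas: "?T \<in> measurable ?P ?P"
    by (intro measurable_restrict measurable_compose[OF _ T(1)] measurable_component_singleton)
  show ?thesis
  proof (rule PiM_eqI[OF I])
    fix A assume A: "\<And>i. i \<in> I \<Longrightarrow> A i \<in> sets M"
    let ?B = "\<lambda>i. T i -` A i \<inter> space M"
    have "?T -` Pi\<^sub>E I A \<inter> space ?P = Pi\<^sub>E I ?B"
      by (auto simp: space_PiM PiE_iff)
    then have "emeasure (distr ?P ?P ?T) (Pi\<^sub>E I A) = emeasure ?P (Pi\<^sub>E I ?B)"
      by (subst emeasure_distr[OF meas]) (auto intro!: sets_PiM_I_finite I A)
    also have "\<dots> = (\<Prod>i\<in>I. emeasure M (?B i))"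
      by (rule emeasure_PiM[OF I]) (rule measurable_sets[OF T(1) A])
    also have "\<dots> = (\<Prod>i\<in>I. emeasure M (A i))"
    proof (rule prod.cong[OF refl])
      fix i assume "i \<in> I"
      then have "emeasure M (?B i) = emeasure (distr M M (T i)) (A i)"
        by (intro emeasure_distr[symmetric] T A)
      then show "emeasure M (?B i) = emeasure M (A i)"
        unfolding T(2) .
    qed
    finally show "emeasure (distr ?P ?P ?T) (Pi\<^sub>E I A) = (\<Prod>i\<in>I. emeasure M (A i))" .
  qed simp
qed

abbreviation sphere_PiM :: "'i set \<Rightarrow> ('i \<Rightarrow> 'a::euclidean_space) measure" where
  "sphere_PiM I \<equiv> PiM I (\<lambda>_. uniform_sphere)"

lemma prob_space_sphere_PiM: "prob_space (sphere_PiM I)"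
  by (rule prob_space_PiM) (rule prob_space_uniform_sphere)

lemma product_sigma_finite_uniform_sphere: "product_sigma_finite (\<lambda>_. uniform_sphere)"
  by (rule product_sigma_finite.intro) (intro prob_space_imp_sigma_finite prob_space_uniform_sphere)

text \<open>Letting \<open>T\<close> vary with the coordinate covers both a common rotation of all
  points and separate sign changes.\<close>

lemma sphere_PiM_orthogonal:
  fixes T :: "'i::finite \<Rightarrow> 'a::euclidean_space \<Rightarrow> 'a"
  assumes T: "\<And>i. orthogonal_transformation (T i)"
    and f: "f \<in> borel_measurable (sphere_PiM UNIV)"
  shows "(\<integral>\<^sup>+x. f x \<partial>sphere_PiM UNIV) = (\<integral>\<^sup>+x. f (\<lambda>i. T i (x i)) \<partial>sphere_PiM UNIV)"
proof -
  have [measurable]: "T i \<in> borel_measurable borel" for i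
    using orthogonal_transformation_linear[OF T]
    by (intro borel_measurable_continuous_onI linear_continuous_on) (simp add: linear_conv_bounded_linear)
  have "distr (sphere_PiM UNIV) (sphere_PiM UNIV) (\<lambda>x. \<lambda>i\<in>UNIV. T i (x i)) = sphere_PiM UNIV"
  proof (rule distr_PiM_component[OF finite])
    show "distr uniform_sphere uniform_sphere (T i) = uniform_sphere" for i
      using uniform_sphere_orthogonal_invariant[OF T] by (simp cong: distr_cong)
  qed (auto intro: prob_space_imp_sigma_finite prob_space_uniform_sphere)
  then have "(\<integral>\<^sup>+x. f x \<partial>sphere_PiM UNIV)
    = (\<integral>\<^sup>+x. f x \<partial>distr (sphere_PiM UNIV) (sphere_PiM UNIV) (\<lambda>x i. T i (x i)))"
    by (simp add: restrict_UNIV)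
  also have "\<dots> = (\<integral>\<^sup>+x. f (\<lambda>i. T i (x i)) \<partial>sphere_PiM UNIV)"
    using f by (intro nn_integral_distr) (auto intro!: measurable_PiM_single')
  finally show ?thesis .
qed

text \<open>Distinct coordinates of the product are again independent and uniform.\<close>

lemma sphere_PiM_reindex:
  fixes g :: "'i::finite \<Rightarrow> 'j::finite"
  assumes g: "inj g" and f: "f \<in> borel_measurable (sphere_PiM UNIV)"
  shows "(\<integral>\<^sup>+x. f (\<lambda>i. x (g i)) \<partial>sphere_PiM UNIV) = (\<integral>\<^sup>+x. f x \<partial>(sphere_PiM UNIV :: ('i \<Rightarrow> 'a::euclidean_space) measure))"
proof -
  have "distr (sphere_PiM UNIV) (sphere_PiM UNIV) (\<lambda>x. \<lambda>i\<in>UNIV. x (g i)) = (sphere_PiM UNIV :: ('i \<Rightarrow> 'a) measure)"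
    using g by (intro distr_PiM_reindex prob_space_uniform_sphere) auto
  then have "(\<integral>\<^sup>+x. f x \<partial>sphere_PiM UNIV)
    = (\<integral>\<^sup>+x. f x \<partial>distr (sphere_PiM UNIV) (sphere_PiM UNIV) (\<lambda>x i. x (g i)))"
    by (simp add: restrict_UNIV)
  also have "\<dots> = (\<integral>\<^sup>+x. f (\<lambda>i. x (g i)) \<partial>sphere_PiM UNIV)"
    using f by (intro nn_integral_distr) (auto intro!: measurable_PiM_single')
  finally show ?thesis by simp
qed

text \<open>Coordinate \<open>k\<close> is integrated separately; the other integral still runs over
  all coordinates, the overwritten one included, so that the index set stays
  \<open>UNIV\<close>.\<close>

lemma sphere_PiM_Fubini:
  fixes k :: "'i::finite" and f :: "('i \<Rightarrow> 'a::euclidean_space) \<Rightarrow> ennreal"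
  assumes f[measurable]: "f \<in> borel_measurable (sphere_PiM UNIV)"
  shows "(\<integral>\<^sup>+x. f x \<partial>sphere_PiM UNIV) = (\<integral>\<^sup>+u. \<integral>\<^sup>+x. f (x(k := u)) \<partial>sphere_PiM UNIV \<partial>uniform_sphere)" (is ?A)
    and "(\<integral>\<^sup>+x. f x \<partial>sphere_PiM UNIV) = (\<integral>\<^sup>+x. \<integral>\<^sup>+u. f (x(k := u)) \<partial>uniform_sphere \<partial>sphere_PiM UNIV)" (is ?B)
proof -
  interpret product_sigma_finite "\<lambda>_::'i. uniform_sphere :: 'a measure"
    by (rule product_sigma_finite_uniform_sphere)
  interpret U: prob_space "uniform_sphere :: 'a measure" by (rule prob_space_uniform_sphere)
  have ins: "insert k (UNIV - {k}) = UNIV" by auto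
  have g: "g \<in> borel_measurable (sphere_PiM (insert k (UNIV - {k})))"
    if "g \<in> borel_measurable (sphere_PiM UNIV)" for g :: "('i \<Rightarrow> 'a) \<Rightarrow> ennreal"
    using that by (simp add: ins)
  have upd: "(\<lambda>x. x(k := u)) \<in> measurable (sphere_PiM UNIV) (sphere_PiM UNIV :: ('i \<Rightarrow> 'a) measure)" for u
    by (rule measurable_fun_upd[where J=UNIV]) auto
  have upd2: "(\<lambda>(x, u). x(k := u)) \<in> measurable (sphere_PiM UNIV \<Otimes>\<^sub>M uniform_sphere) (sphere_PiM UNIV :: ('i \<Rightarrow> 'a) measure)"
    unfolding case_prod_beta by (rule measurable_fun_upd[where J=UNIV]) auto
  \<comment> \<open>A coordinate on which \<open>h\<close> does not depend integrates to the total
    mass 1.\<close>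
  have drop: "(\<integral>\<^sup>+x. h x \<partial>sphere_PiM UNIV) = (\<integral>\<^sup>+x. h x \<partial>sphere_PiM (UNIV - {k}))"
    if h: "h \<in> borel_measurable (sphere_PiM UNIV)" and hk: "\<And>x u. h (x(k := u)) = h x" for h :: "('i \<Rightarrow> 'a) \<Rightarrow> ennreal"
  proof -
    have "(\<integral>\<^sup>+x. h x \<partial>sphere_PiM (insert k (UNIV - {k}))) = (\<integral>\<^sup>+x. \<integral>\<^sup>+u. h (x(k := u)) \<partial>uniform_sphere \<partial>sphere_PiM (UNIV - {k}))"
      by (rule product_nn_integral_insert) (use g[OF h] in auto)
    then show ?thesis by (simp add: ins hk U.emeasure_space_1[simplified])
  qed
  have "(\<integral>\<^sup>+x. f x \<partial>sphere_PiM (insert k (UNIV - {k}))) = (\<integral>\<^sup>+u. \<integral>\<^sup>+x. f (x(k := u)) \<partial>sphere_PiM (UNIV - {k}) \<partial>uniform_sphere)"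
    by (rule product_nn_integral_insert_rev) (use g[OF f] in auto)
  also have "\<dots> = (\<integral>\<^sup>+u. \<integral>\<^sup>+x. f (x(k := u)) \<partial>sphere_PiM UNIV \<partial>uniform_sphere)"
    by (intro nn_integral_cong drop[symmetric] measurable_compose[OF upd f]) simp
  finally show ?A by (simp add: ins)
  have "(\<integral>\<^sup>+x. f x \<partial>sphere_PiM (insert k (UNIV - {k}))) = (\<integral>\<^sup>+x. \<integral>\<^sup>+u. f (x(k := u)) \<partial>uniform_sphere \<partial>sphere_PiM (UNIV - {k}))"
    by (rule product_nn_integral_insert) (use g[OF f] in auto)
  also have "\<dots> = (\<integral>\<^sup>+x. \<integral>\<^sup>+u. f (x(k := u)) \<partial>uniform_sphere \<partial>sphere_PiM UNIV)"
  proof (rule drop[symmetric])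
    have "(\<lambda>(x, u). f (x(k := u))) \<in> borel_measurable (sphere_PiM UNIV \<Otimes>\<^sub>M uniform_sphere)"
      using measurable_compose[OF upd2 f] by (simp add: case_prod_beta)
    then show "(\<lambda>x. \<integral>\<^sup>+u. f (x(k := u)) \<partial>uniform_sphere) \<in> borel_measurable (sphere_PiM UNIV)"
      by (rule sigma_finite_measure.borel_measurable_nn_integral[OF prob_space_imp_sigma_finite[OF prob_space_uniform_sphere]])
  qed simp
  finally show ?B by (simp add: ins)
qed

section \<open>Matrices with random rows in \<open>K\<close> and standard basis rows
  elsewhere\<close>

lemma measurable_det_rows [measurable (raw)]:
  assumes "\<And>i. (\<lambda>x. f x i) \<in> measurable M borel"
  shows "(\<lambda>x. det_rows (f x)) \<in> borel_measurable M"
proof -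
  have [measurable]: "(\<lambda>x. f x i $ j) \<in> borel_measurable M" for i j
    using measurable_compose[OF assms, of "\<lambda>v. v $ j"] by (auto intro: borel_measurable_continuous_onI continuous_intros)
  show ?thesis
    unfolding det_rows_def det_def by simp
qed

text \<open>Interpolates between the identity matrix (\<open>K = {}\<close>) and the fully random
  one (\<open>K = UNIV\<close>), for inductions on \<open>K\<close>.\<close>

definition mixed_rows :: "'n set \<Rightarrow> ('n::finite \<Rightarrow> real ^ 'n) \<Rightarrow> 'n \<Rightarrow> real ^ 'n" where
  "mixed_rows K x i = (if i \<in> K then x i else axis i 1)"

lemma measurable_mixed_rows [measurable]: "(\<lambda>x. mixed_rows K x i) \<in> measurable (sphere_PiM UNIV) borel"
  unfolding mixed_rows_def by (cases "i \<in> K") auto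

lemma mixed_rows_insert: "mixed_rows (insert k K) x = (mixed_rows K x)(k := x k)"
  by (auto simp: mixed_rows_def)

lemma mixed_rows_upd: "k \<notin> K \<Longrightarrow> mixed_rows K (x(k := u)) = mixed_rows K x"
  by (auto simp: mixed_rows_def fun_eq_iff)

lemma mixed_rows_axis: "k \<notin> K \<Longrightarrow> (mixed_rows K x)(k := axis k 1) = mixed_rows K x"
  by (auto simp: mixed_rows_def fun_eq_iff)

lemma mixed_rows_UNIV [simp]: "mixed_rows UNIV x = x"
  by (simp add: mixed_rows_def fun_eq_iff)

lemma det_mixed_rows_empty [simp]: "det_rows (mixed_rows {} x) = 1"
proof -
  have "(\<chi> i. mixed_rows {} x i) = mat 1"
    by (auto simp: mixed_rows_def mat_def axis_def vec_eq_iff)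
  then show ?thesis by (simp add: det_rows_def)
qed

lemma linear_functional_inner:
  fixes f :: "'a::euclidean_space \<Rightarrow> real"
  assumes "linear f"
  obtains a where "\<And>v. f v = a \<bullet> v"
proof (rule that)
  fix v
  have "f v = f (\<Sum>i\<in>Basis. (v \<bullet> i) *\<^sub>R i)"
    by (simp add: euclidean_representation)
  then show "f v = (\<Sum>i\<in>Basis. f i *\<^sub>R i) \<bullet> v"
    by (simp add: linear_sum[OF assms] linear_scale[OF assms] inner_sum_left inner_commute[of v] mult.commute)
qed

text \<open>Induction on \<open>K\<close>: with the other rows fixed, the determinant is a linear
  form in row \<open>k\<close>. This form is almost surely nonzero, so its zero set is a hyperplane,
  which is null for the uniform distribution.\<close>

lemma AE_det_mixed_rows_nonzero:
  "AE x in sphere_PiM (UNIV :: 'n::finite set). det_rows (mixed_rows K x) \<noteq> 0"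
proof -
  have "finite K" by simp
  then show ?thesis
  proof (induction K)
    case empty
    then show ?case by simp
  next
    case (insert k K)
    let ?P = "sphere_PiM (UNIV :: 'n set) :: ('n \<Rightarrow> real ^ 'n) measure"
    have "(\<integral>\<^sup>+x. indicator {x. det_rows (mixed_rows (insert k K) x) = 0} x \<partial>?P)
      = (\<integral>\<^sup>+x. \<integral>\<^sup>+u. indicator {x. det_rows (mixed_rows (insert k K) x) = 0} (x(k := u)) \<partial>uniform_sphere \<partial>?P)"
      by (rule sphere_PiM_Fubini) (measurable)
    also have "\<dots> = (\<integral>\<^sup>+x. 0 \<partial>?P)"
    proof (rule nn_integral_cong_AE)
      show "AE x in ?P. (\<integral>\<^sup>+u. indicator {x. det_rows (mixed_rows (insert k K) x) = 0} (x(k := u)) \<partial>uniform_sphere) = 0"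
        using insert.IH
      proof eventually_elim
        case (elim x)
        obtain a where a: "\<And>v. det_rows ((mixed_rows K x)(k := v)) = a \<bullet> v"
          using linear_functional_inner[OF linear_det_rows_upd] by blast
        \<comment> \<open>The value of the form at the axis vector of index \<open>k\<close> is the
          determinant of the previous stage.\<close>
        have "a \<noteq> 0"
          using a[of "axis k 1"] elim insert by (auto simp: mixed_rows_axis)
        then have "AE u in uniform_sphere. a \<bullet> u \<noteq> 0"
          by (rule AE_uniform_sphere_hyperplane)
        then have "(\<integral>\<^sup>+u. indicator {x. det_rows (mixed_rows (insert k K) x) = 0} (x(k := u)) \<partial>uniform_sphere)
            = (\<integral>\<^sup>+u. 0 \<partial>(uniform_sphere :: (real^'n) measure))"
          using insert by (intro nn_integral_cong_AE) (auto simp: mixed_rows_insert mixed_rows_upd a elim!: eventually_mono)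
        then show ?case by simp
      qed
    qed
    finally have "(\<integral>\<^sup>+x. indicator {x. det_rows (mixed_rows (insert k K) x) = 0} x \<partial>?P) = 0"
      by simp
    then have "AE x in ?P. indicator {x. det_rows (mixed_rows (insert k K) x) = 0} x = (0::ennreal)"
      by (subst (asm) nn_integral_0_iff_AE) measurable
    then show ?case
      by eventually_elim (simp add: indicator_def split: if_splits)
  qed
qed

section \<open>The mean absolute determinant\<close>

text \<open>This is the Householder reflection; for \<open>v = 0\<close> it is the identity.\<close>

lemma orthogonal_transformation_reflection:
  fixes v :: "'a::euclidean_space"
  shows "orthogonal_transformation (\<lambda>x. x - (2 * (x \<bullet> v) / (v \<bullet> v)) *\<^sub>R v)"
proof (cases "v = 0")
  case True
  then show ?thesis by (simp add: orthogonal_transformation_def linear_iff)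
next
  case False
  then have v: "v \<bullet> v \<noteq> 0" by simp
  have "linear (\<lambda>x. x - (2 * (x \<bullet> v) / (v \<bullet> v)) *\<^sub>R v)"
    by (rule linearI) (simp_all add: inner_add_left add_divide_distrib algebra_simps)
  moreover have "(x - (2 * (x \<bullet> v) / (v \<bullet> v)) *\<^sub>R v) \<bullet> (y - (2 * (y \<bullet> v) / (v \<bullet> v)) *\<^sub>R v) = x \<bullet> y" for x y
  proof -
    define a where "a = 2 * (x \<bullet> v) / (v \<bullet> v)"
    define b where "b = 2 * (y \<bullet> v) / (v \<bullet> v)"
    have a: "a * (v \<bullet> v) = 2 * (x \<bullet> v)" and b: "b * (v \<bullet> v) = 2 * (y \<bullet> v)"
      using v by (simp_all add: a_def b_def)
    have "(x - a *\<^sub>R v) \<bullet> (y - b *\<^sub>R v) = x \<bullet> y - b * (x \<bullet> v) - a * (y \<bullet> v) + b * (a * (v \<bullet> v))"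
      by (simp add: inner_diff_left inner_diff_right inner_commute[of v y] algebra_simps)
    also have "\<dots> = x \<bullet> y + b * (x \<bullet> v) - a * (y \<bullet> v)"
      by (simp add: a)
    also have "\<dots> = x \<bullet> y"
      by (simp add: a_def b_def)
    finally show ?thesis
      by (simp only: a_def b_def)
  qed
  ultimately show ?thesis
    by (simp add: orthogonal_transformation_def)
qed

text \<open>Reflect in the hyperplane bisecting \<open>w\<close> and
  \<open>norm w *\<^sub>R axis k 1\<close>. Their difference vanishes outside \<open>K\<close>, so
  the axis vectors with index outside \<open>K\<close> are orthogonal to it and stay fixed.\<close>

lemma orthogonal_reflection_to_axis:
  fixes w :: "real ^ 'n"
  assumes k: "k \<in> K" and w: "\<And>i. i \<notin> K \<Longrightarrow> w $ i = 0"
  obtains T :: "real ^ 'n \<Rightarrow> real ^ 'n" where "orthogonal_transformation T" "T w = norm w *\<^sub>R axis k 1" "\<And>i. i \<notin> K \<Longrightarrow> T (axis i 1) = axis i 1"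
proof -
  define v where "v = w - norm w *\<^sub>R axis k 1"
  define T where "T x = x - (2 * (x \<bullet> v) / (v \<bullet> v)) *\<^sub>R v" for x
  have "orthogonal_transformation T"
    unfolding T_def by (rule orthogonal_transformation_reflection)
  \<comment> \<open>Equality of the two lengths makes the coefficient of \<open>v\<close> in
    \<open>T w\<close> equal to 1, unless \<open>v = 0\<close>.\<close>
  have "w \<bullet> w = (norm w *\<^sub>R axis k 1) \<bullet> (norm w *\<^sub>R axis k 1 :: real ^ 'n)"
    by (simp only: inner_scaleR_left inner_scaleR_right inner_axis_axis dot_square_norm[of w] power2_eq_square inner_real_def) simp
  then have "v \<bullet> v = 2 * (w \<bullet> v)"
    unfolding v_def inner_diff_left inner_diff_right inner_commute[of "norm w *\<^sub>R axis k 1" w]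
    by (simp del: inner_scaleR_left inner_scaleR_right)
  then have "T w = w - v"
    by (cases "v = 0") (auto simp: T_def)
  then have "T w = norm w *\<^sub>R axis k 1"
    by (simp add: v_def)
  moreover have "T (axis i 1) = axis i 1" if "i \<notin> K" for i
  proof -
    have "v $ i = 0"
      using that k w by (auto simp: v_def axis_def)
    then show ?thesis
      by (simp add: T_def inner_axis')
  qed
  ultimately show ?thesis
    by (rule that[OF \<open>orthogonal_transformation T\<close>])
qed

text \<open>Applying \<open>T\<close> to all rows multiplies the matrix on the right by an
  orthogonal one.\<close>

lemma det_rows_orthogonal:
  assumes "orthogonal_transformation T"
  shows "\<bar>det_rows (\<lambda>i. T (x i))\<bar> = \<bar>det_rows x\<bar>"
proof -
  let ?Q = "matrix T"
  have T: "T = (*v) ?Q"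
    using matrix_works[OF orthogonal_transformation_linear[OF assms, unfolded linear_matrix_vector_mul_eq[symmetric]]]
      orthogonal_transformation_linear[OF assms] by (metis matrix_vector_mul)
  have "(\<chi> i. T (x i)) = (\<chi> i. x i) ** transpose ?Q"
    by (subst T) (simp add: vec_eq_iff matrix_matrix_mult_def matrix_vector_mult_def transpose_def mult.commute)
  then have "det_rows (\<lambda>i. T (x i)) = det_rows x * det ?Q"
    by (simp add: det_rows_def det_mul det_transpose)
  moreover have "\<bar>det ?Q\<bar> = 1"
    using det_orthogonal_matrix[of ?Q] assms by (auto simp: orthogonal_transformation_matrix)
  ultimately show ?thesis by (simp add: abs_mult)
qed

text \<open>Components of \<open>u\<close> along axis vectors that already occur as rows only
  produce repeated rows.\<close>

lemma det_mixed_rows_project: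
  assumes "k \<notin> K"
  shows "det_rows ((mixed_rows K x)(k := u))
    = det_rows ((mixed_rows K x)(k := (\<chi> i. if i \<in> insert k K then u $ i else 0)))"
proof -
  define w where "w = (\<chi> i. if i \<in> insert k K then u $ i else 0)"
  have "(\<Sum>i\<in>- insert k K. (u $ i) *\<^sub>R axis i 1) $ j = (u - w) $ j" for j
  proof -
    have "(\<Sum>i\<in>- insert k K. (u $ i) *\<^sub>R axis i 1) $ j = (\<Sum>i\<in>- insert k K. if i = j then u $ i else 0)"
      unfolding sum_component by (intro sum.cong refl) (simp add: axis_def)
    also have "\<dots> = (u - w) $ j"
      by (subst sum.delta) (auto simp: w_def)
    finally show ?thesis .
  qed
  then have "u - w = (\<Sum>i\<in>- insert k K. (u $ i) *\<^sub>R axis i 1)"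
    by (simp add: vec_eq_iff)
  then have "det_rows ((mixed_rows K x)(k := u - w))
      = (\<Sum>i\<in>- insert k K. u $ i * det_rows ((mixed_rows K x)(k := axis i 1)))"
    by (simp only: linear_sum[OF linear_det_rows_upd] linear_scale[OF linear_det_rows_upd] real_scaleR_def)
  also have "\<dots> = 0"
  proof (intro sum.neutral ballI)
    fix i assume i: "i \<in> - insert k K"
    have "det_rows ((mixed_rows K x)(k := axis i 1)) = 0"
      by (rule det_rows_eq_0[of i k]) (use i in \<open>auto simp: mixed_rows_def\<close>)
    then show "u $ i * det_rows ((mixed_rows K x)(k := axis i 1)) = 0"
      by simp
  qed
  finally show ?thesis
    by (simp only: linear_diff[OF linear_det_rows_upd] w_def[symmetric] eq_iff_diff_eq_0[symmetric])
qed

definition abs_det_moment :: "'n::finite set \<Rightarrow> ennreal" where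
  "abs_det_moment K = (\<integral>\<^sup>+x. ennreal \<bar>det_rows (mixed_rows K x)\<bar> \<partial>sphere_PiM UNIV)"

text \<open>Fix row \<open>k\<close> as \<open>u\<close>; only its projection \<open>w\<close>
  counts. A reflection turns \<open>w\<close> to the axis of index \<open>k\<close> and fixes the
  other nonrandom rows, and invariance of the random rows absorbs it. This leaves
  \<open>norm w\<close> times the previous determinant, and the mean of \<open>norm w\<close> is
  known.\<close>

lemma abs_det_moment_insert:
  fixes K :: "'n::finite set"
  assumes k: "k \<notin> K"
  shows "abs_det_moment (insert k K)
    = ennreal (Gamma ((real (card K) + 2) / 2) * Gamma (CARD('n) / 2) / (Gamma ((real (card K) + 1) / 2) * Gamma ((real CARD('n) + 1) / 2)))
      * abs_det_moment K"
proof -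
  let ?P = "sphere_PiM (UNIV :: 'n set) :: ('n \<Rightarrow> real ^ 'n) measure"
  let ?A = "(\<lambda>i. axis i 1) ` insert k K :: (real ^ 'n) set"
  have A: "?A \<subseteq> Basis" "?A \<noteq> {}" by (auto simp: Basis_vec_def)
  have inj: "inj (\<lambda>i::'n. axis i 1 :: real ^ 'n)"
    by (auto simp: inj_def axis_eq_axis)
  \<comment> \<open>The projection is to \<open>card K + 1\<close> coordinates, whence
    \<open>card K + 2\<close> in the first Gamma argument.\<close>
  have card: "card ?A = card K + 1"
    using k by (subst card_image[OF inj_on_subset[OF inj subset_UNIV]]) simp
  have inner: "(\<integral>\<^sup>+x. ennreal \<bar>det_rows ((mixed_rows K x)(k := u))\<bar> \<partial>?P) = ennreal (sqrt (coord_sq ?A u)) * abs_det_moment K" for u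
  proof -
    define w where "w = (\<chi> i. if i \<in> insert k K then u $ i else 0)"
    have "(norm w)\<^sup>2 = (\<Sum>i\<in>UNIV. (w $ i)\<^sup>2)"
      by (simp add: norm_vec_def L2_set_def sum_nonneg)
    also have "\<dots> = (\<Sum>i\<in>insert k K. (u $ i)\<^sup>2)"
      by (intro sum.mono_neutral_cong_right) (auto simp: w_def)
    also have "\<dots> = coord_sq ?A u"
      unfolding coord_sq_def by (subst sum.reindex[OF inj_on_subset[OF inj subset_UNIV]]) (simp add: inner_axis)
    finally have nw: "norm w = sqrt (coord_sq ?A u)"
      by (metis norm_ge_zero real_sqrt_unique)
    have uw: "det_rows ((mixed_rows K x)(k := u)) = det_rows ((mixed_rows K x)(k := w))" for x
      unfolding w_def by (rule det_mixed_rows_project[OF k])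
    obtain T :: "real ^ 'n \<Rightarrow> real ^ 'n" where T: "orthogonal_transformation T" "T w = norm w *\<^sub>R axis k 1"
        "\<And>i. i \<notin> insert k K \<Longrightarrow> T (axis i 1) = axis i 1"
      using orthogonal_reflection_to_axis[of k "insert k K" w] by (auto simp: w_def)
    have "\<bar>det_rows ((mixed_rows K x)(k := w))\<bar> = norm w * \<bar>det_rows (mixed_rows K (\<lambda>i. T (x i)))\<bar>" for x
    proof -
      have "\<bar>det_rows ((mixed_rows K x)(k := w))\<bar> = \<bar>det_rows (\<lambda>i. T (((mixed_rows K x)(k := w)) i))\<bar>"
        by (rule det_rows_orthogonal[OF T(1), symmetric])
      also have "(\<lambda>i. T (((mixed_rows K x)(k := w)) i)) = (mixed_rows K (\<lambda>i. T (x i)))(k := norm w *\<^sub>R axis k 1)"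
        using T by (auto simp: fun_eq_iff mixed_rows_def)
      finally show ?thesis
        unfolding det_rows_upd_scale mixed_rows_axis[OF k] abs_mult abs_norm_cancel .
    qed
    then have "(\<integral>\<^sup>+x. ennreal \<bar>det_rows ((mixed_rows K x)(k := u))\<bar> \<partial>?P)
        = (\<integral>\<^sup>+x. ennreal (norm w) * ennreal \<bar>det_rows (mixed_rows K (\<lambda>i. T (x i)))\<bar> \<partial>?P)"
      by (simp only: uw ennreal_mult norm_ge_zero abs_ge_zero)
    also have "\<dots> = (\<integral>\<^sup>+x. ennreal (norm w) * ennreal \<bar>det_rows (mixed_rows K x)\<bar> \<partial>?P)"
      by (rule sphere_PiM_orthogonal[symmetric, where T="\<lambda>_. T"
            and f="\<lambda>x. ennreal (norm w) * ennreal \<bar>det_rows (mixed_rows K x)\<bar>"], rule T(1)) measurable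
    also have "\<dots> = ennreal (norm w) * abs_det_moment K"
      unfolding abs_det_moment_def by (rule nn_integral_cmult) measurable
    finally show ?thesis by (simp add: nw)
  qed
  have "abs_det_moment (insert k K) = (\<integral>\<^sup>+u. \<integral>\<^sup>+x. ennreal \<bar>det_rows (mixed_rows (insert k K) (x(k := u)))\<bar> \<partial>?P \<partial>uniform_sphere)"
    unfolding abs_det_moment_def by (rule sphere_PiM_Fubini(1)) measurable
  also have "\<dots> = (\<integral>\<^sup>+u. ennreal (sqrt (coord_sq ?A u)) * abs_det_moment K \<partial>uniform_sphere)"
    using k by (simp add: mixed_rows_insert mixed_rows_upd inner)
  also have "\<dots> = (\<integral>\<^sup>+u. ennreal (sqrt (coord_sq ?A u)) \<partial>uniform_sphere) * abs_det_moment K"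
    by (rule nn_integral_multc) measurable
  finally show ?thesis
    by (simp only: uniform_sphere_coord_norm[OF A] card) (simp add: add.commute)
qed

text \<open>The step factors telescope: each denominator
  \<open>Gamma ((real (card K) + 1) / 2)\<close> cancels against the value for \<open>K\<close>. The
  start is \<open>Gamma (1 / 2) / sqrt pi = 1\<close>.\<close>

lemma abs_det_moment:
  fixes K :: "'n::finite set"
  shows "abs_det_moment K = ennreal (Gamma ((real (card K) + 1) / 2) / sqrt pi * (Gamma (CARD('n) / 2) / Gamma ((real CARD('n) + 1) / 2)) ^ card K)"
proof -
  have "finite K" by simp
  then show ?thesis
  proof (induction K)
    case empty
    interpret prob_space "sphere_PiM (UNIV :: 'n set) :: ('n \<Rightarrow> real ^ 'n) measure"
      by (rule prob_space_sphere_PiM)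
    show ?case
      by (simp add: abs_det_moment_def emeasure_space_1 Gamma_one_half_real)
  next
    case (insert k K)
    have telescope: "a * b / (c * e) * (c / s * (b / e) ^ m) = a / s * (b / e) ^ Suc m" if "0 < c"
      for a b c e s :: real and m
      using that by simp
    have "0 < Gamma ((real (card K) + 1) / 2)" "0 < Gamma (real CARD('n) / 2)" "0 < Gamma ((real CARD('n) + 1) / 2)"
      "0 < Gamma ((real (card K) + 2) / 2)"
      by (auto intro!: Gamma_real_pos)
    then have "abs_det_moment (insert k K) = ennreal (Gamma ((real (card K) + 2) / 2) * Gamma (real CARD('n) / 2)
        / (Gamma ((real (card K) + 1) / 2) * Gamma ((real CARD('n) + 1) / 2))
      * (Gamma ((real (card K) + 1) / 2) / sqrt pi * (Gamma (real CARD('n) / 2) / Gamma ((real CARD('n) + 1) / 2)) ^ card K))"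
      unfolding abs_det_moment_insert[OF insert(2)] insert.IH
      by (intro ennreal_mult[symmetric] mult_nonneg_nonneg divide_nonneg_nonneg zero_le_power) simp_all
    also have "Gamma ((real (card K) + 2) / 2) * Gamma (real CARD('n) / 2)
        / (Gamma ((real (card K) + 1) / 2) * Gamma ((real CARD('n) + 1) / 2))
      * (Gamma ((real (card K) + 1) / 2) / sqrt pi * (Gamma (real CARD('n) / 2) / Gamma ((real CARD('n) + 1) / 2)) ^ card K)
      = Gamma ((real (card K) + 2) / 2) / sqrt pi * (Gamma (real CARD('n) / 2) / Gamma ((real CARD('n) + 1) / 2)) ^ Suc (card K)"
      by (rule telescope) fact
    finally show ?case
      using insert(1,2) by (simp add: add.commute)
  qed
qed

section \<open>Symmetrisation\<close>

definition same_sign :: "('i \<Rightarrow> real) \<Rightarrow> bool" where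
  "same_sign f \<longleftrightarrow> (\<forall>j. 0 < f j) \<or> (\<forall>j. f j < 0)"

lemma same_sign_scale:
  assumes "c \<noteq> 0"
  shows "same_sign (\<lambda>j. c * f j) \<longleftrightarrow> same_sign f"
  using assms by (cases "0 < c") (auto simp: same_sign_def zero_less_mult_iff mult_less_0_iff)

lemma same_sign_abs_sum:
  fixes f :: "'i::finite \<Rightarrow> real"
  assumes "same_sign f"
  shows "\<bar>sum f UNIV\<bar> = (\<Sum>j\<in>UNIV. \<bar>f j\<bar>)"
proof (cases "\<forall>j. 0 < f j")
  case True
  then show ?thesis by (simp add: sum_nonneg less_imp_le abs_of_pos)
next
  case False
  with assms have "\<forall>j. f j < 0" by (auto simp: same_sign_def)
  then show ?thesis
    by (simp add: sum_nonpos less_imp_le abs_of_neg abs_of_nonpos sum_negf)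
qed

lemma pred_same_sign [measurable]:
  fixes f :: "'a \<Rightarrow> 'i::finite \<Rightarrow> real"
  assumes [measurable]: "\<And>j. (\<lambda>x. f x j) \<in> borel_measurable M"
  shows "Measurable.pred M (\<lambda>x. same_sign (f x))"
proof -
  have "Measurable.pred M (\<lambda>x. (\<forall>j\<in>UNIV. 0 < f x j) \<or> (\<forall>j\<in>UNIV. f x j < 0))"
    by (intro pred_intros_logic pred_intros_finite) measurable
  then show ?thesis by (simp add: same_sign_def)
qed

text \<open>\<open>s j\<close> says that \<open>f j\<close> is negated. The admissible patterns
  negate exactly the negative values or exactly the positive ones.\<close>

lemma count_sign_patterns:
  fixes f :: "'i::finite \<Rightarrow> real"
  assumes "\<And>j. f j \<noteq> 0"
  shows "card {s. same_sign (\<lambda>j. (if s j then - 1 else 1) * f j)} = 2"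
proof -
  have "{s. same_sign (\<lambda>j. (if s j then - 1 else 1) * f j)} = {\<lambda>j. f j < 0, \<lambda>j. 0 < f j}"
  proof (intro set_eqI iffI)
    fix s assume "s \<in> {s. same_sign (\<lambda>j. (if s j then - 1 else 1) * f j)}"
    then consider "\<forall>j. 0 < (if s j then - 1 else 1) * f j" | "\<forall>j. (if s j then - 1 else 1) * f j < 0"
      by (auto simp: same_sign_def)
    then show "s \<in> {\<lambda>j. f j < 0, \<lambda>j. 0 < f j}"
    proof cases
      case 1
      then have "s j \<longleftrightarrow> f j < 0" for j
        by (cases "s j") (auto dest: spec[of _ j])
      then show ?thesis by (simp add: fun_eq_iff)
    next
      case 2
      then have "s j \<longleftrightarrow> 0 < f j" for j
        by (cases "s j") (auto dest: spec[of _ j])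
      then show ?thesis by (simp add: fun_eq_iff)
    qed
  next
    fix s assume "s \<in> {\<lambda>j. f j < 0, \<lambda>j. 0 < f j}"
    then show "s \<in> {s. same_sign (\<lambda>j. (if s j then - 1 else 1) * f j)}"
      using assms by (auto simp: same_sign_def not_less order_less_le)
  qed
  \<comment> \<open>The two patterns are complementary, hence distinct because the index type is
    nonempty.\<close>
  moreover have "(\<lambda>j. f j < 0) \<noteq> (\<lambda>j. 0 < f j)"
  proof
    assume "(\<lambda>j. f j < 0) = (\<lambda>j. 0 < f j)"
    then have "f undefined < 0 \<longleftrightarrow> 0 < f undefined" by (rule fun_cong)
    then show False using assms[of undefined] by linarith
  qed
  ultimately show ?thesis by simp
qed

text \<open>If the simplex is degenerate, both sides vanish because of the volume factor; so the equation
  holds for all points, and it makes the integrand of the theorem Borel measurable.\<close>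

lemma measure_simplex_of_bool:
  fixes x :: "'n::finite \<Rightarrow> real ^ 'n"
  shows "measure lborel (convex hull (insert u (range x))) *
      of_bool (0 \<in> rel_interior (convex hull (range (\<lambda>i. proj_perp u (x i)))))
    = \<bar>det_rows x - (\<Sum>j\<in>UNIV. det_rows (x(j := u)))\<bar> * of_bool (same_sign (\<lambda>j. det_rows (x(j := u)))) / fact CARD('n)"
proof (cases "det_rows (\<lambda>i. x i - u) = 0")
  case True
  then show ?thesis by (simp add: measure_simplex det_rows_diff)
next
  case False
  from zero_in_rel_interior_proj_perp_iff[OF False] show ?thesis
    by (simp only: measure_simplex det_rows_diff same_sign_def) simp
qed

text \<open>Take norms in Cramer's rule.\<close>

lemma abs_det_rows_le:
  fixes x :: "'n::finite \<Rightarrow> real ^ 'n"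
  assumes "norm u = 1" "\<And>i. norm (x i) = 1"
  shows "\<bar>det_rows x\<bar> \<le> (\<Sum>j\<in>UNIV. \<bar>det_rows (x(j := u))\<bar>)"
proof (cases "det_rows x = 0")
  case False
  have "\<bar>det_rows x\<bar> = norm (det_rows x *\<^sub>R u)"
    using assms by simp
  also have "\<dots> \<le> (\<Sum>j\<in>UNIV. norm (det_rows (x(j := u)) *\<^sub>R x j))"
    unfolding cramer_rows[OF False] by (rule norm_sum)
  finally show ?thesis using assms by simp
qed (simp add: sum_nonneg)

text \<open>\<open>x None\<close> is the distinguished point \<open>x\<^sub>0\<close>.\<close>

definition base :: "('n::finite option \<Rightarrow> real ^ 'n) \<Rightarrow> real" where
  "base x = det_rows (\<lambda>i. x (Some i))"

text \<open>Written as a selection of coordinates by an injective map, so that reindexing the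
  product measure applies directly.\<close>

definition face :: "'n::finite \<Rightarrow> ('n option \<Rightarrow> real ^ 'n) \<Rightarrow> real" where
  "face j x = det_rows (\<lambda>i. x (if i = j then None else Some i))"

lemma face_eq: "face j x = det_rows ((\<lambda>i. x (Some i))(j := x None))"
  unfolding face_def by (intro arg_cong[where f=det_rows]) auto

lemma measurable_base [measurable]: "base \<in> borel_measurable (sphere_PiM UNIV)"
  unfolding base_def by measurable

lemma measurable_face [measurable]: "face j \<in> borel_measurable (sphere_PiM UNIV)"
  unfolding face_def by measurable

lemma base_scale: "base (\<lambda>i. c i *\<^sub>R x i) = (\<Prod>i\<in>UNIV. c (Some i)) * base x"
  unfolding base_def by (rule det_rows_scale_all)

lemma face_scale: "face j (\<lambda>i. c i *\<^sub>R x i) = c None * (\<Prod>i\<in>-{j}. c (Some i)) * face j x"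
proof -
  have "face j (\<lambda>i. c i *\<^sub>R x i) = (\<Prod>i\<in>UNIV. c (if i = j then None else Some i)) * face j x"
    unfolding face_def by (rule det_rows_scale_all)
  also have "(\<Prod>i\<in>UNIV. c (if i = j then None else Some i)) = c None * (\<Prod>i\<in>-{j}. c (Some i))"
    by (subst prod.remove[of _ j]) (auto simp: Compl_eq_Diff_UNIV intro!: prod.cong)
  finally show ?thesis .
qed

lemma face_AE_nonzero: "AE x in sphere_PiM UNIV. face (j::'n::finite) x \<noteq> 0"
proof -
  let ?g = "\<lambda>i::'n. if i = j then None else Some i"
  let ?P = "sphere_PiM UNIV :: ('n option \<Rightarrow> real ^ 'n) measure"
  have "inj ?g"
    by (auto simp: inj_def split: if_splits)
  then have eq: "distr ?P (sphere_PiM UNIV) (\<lambda>x. \<lambda>i\<in>UNIV. x (?g i)) = (sphere_PiM UNIV :: ('n \<Rightarrow> real ^ 'n) measure)"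
    by (intro distr_PiM_reindex prob_space_uniform_sphere) auto
  have "AE x in (sphere_PiM UNIV :: ('n \<Rightarrow> real ^ 'n) measure). det_rows x \<noteq> 0"
    using AE_det_mixed_rows_nonzero[of "UNIV :: 'n set"] by simp
  then have "AE x in distr ?P (sphere_PiM UNIV) (\<lambda>x. \<lambda>i\<in>UNIV. x (?g i)). det_rows x \<noteq> 0"
    unfolding eq .
  then have "AE x in ?P. det_rows (\<lambda>i\<in>UNIV. x (?g i)) \<noteq> 0"
    by (rule AE_distrD[rotated]) (intro measurable_restrict, auto)
  then show ?thesis
    by (simp add: face_def restrict_UNIV)
qed

lemma nn_integral_abs_face:
  fixes j :: "'n::finite"
  shows "(\<integral>\<^sup>+x. ennreal \<bar>face j x\<bar> \<partial>sphere_PiM UNIV) = abs_det_moment (UNIV :: 'n set)"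
proof -
  have "inj (\<lambda>i::'n. if i = j then None else Some i)"
    by (auto simp: inj_def split: if_splits)
  then have "(\<integral>\<^sup>+x. ennreal \<bar>det_rows (\<lambda>i. x (if i = j then None else Some i))\<bar> \<partial>sphere_PiM UNIV)
      = (\<integral>\<^sup>+x. ennreal \<bar>det_rows x\<bar> \<partial>(sphere_PiM UNIV :: ('n \<Rightarrow> real ^ 'n) measure))"
    by (rule sphere_PiM_reindex[where f="\<lambda>x. ennreal \<bar>det_rows x\<bar>"]) measurable
  then show ?thesis
    by (simp add: face_def abs_det_moment_def)
qed

text \<open>Flipping the signs of the points \<open>x (Some k)\<close> by a pattern \<open>s\<close>
  multiplies each \<open>face k x\<close> by the sign of its own index, up to a common sign. Among
  all \<open>2 ^ CARD('n)\<close> patterns exactly two meet the sign condition at almost every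
  point.\<close>

lemma nn_integral_face_same_sign:
  fixes j :: "'n::finite"
  shows "2 ^ CARD('n) * (\<integral>\<^sup>+x. ennreal (\<bar>face j x\<bar> * of_bool (same_sign (\<lambda>k. face k x))) \<partial>sphere_PiM UNIV)
    = 2 * abs_det_moment (UNIV :: 'n set)" (is "_ * ?I = _")
proof -
  let ?P = "sphere_PiM (UNIV :: 'n option set) :: ('n option \<Rightarrow> real ^ 'n) measure"
  let ?e = "\<lambda>b. if b then - 1 else 1 :: real"
  define c where "c s i = (case i of None \<Rightarrow> 1 | Some k \<Rightarrow> ?e (s k))" for s :: "'n \<Rightarrow> bool" and i
  have flip: "?I = (\<integral>\<^sup>+x. ennreal (\<bar>face j x\<bar> * of_bool (same_sign (\<lambda>k. ?e (s k) * face k x))) \<partial>?P)" for s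
  proof -
    have e1: "\<bar>?e b\<bar> = 1" "?e b \<noteq> 0" "?e b * ?e b = 1" for b by auto
    have c: "c s i = 1 \<or> c s i = - 1" for i
      by (auto simp: c_def split: option.split)
    have orth: "orthogonal_transformation (\<lambda>v::real^'n. c s i *\<^sub>R v)" for i
      using c[of i] by (auto simp: orthogonal_transformation_def linear_iff scaleR_right_distrib)
    define p where "p = (\<Prod>i\<in>UNIV. ?e (s i))"
    have p: "p \<noteq> 0" "\<bar>p\<bar> = 1"
      unfolding p_def by (auto simp: abs_prod e1)
    have face: "face k (\<lambda>i. c s i *\<^sub>R x i) = p * (?e (s k) * face k x)" for k x
    proof -
      \<comment> \<open>\<open>face k\<close> contains every point except \<open>x (Some k)\<close>,
        so its factor is \<open>p\<close> without the sign of \<open>k\<close>. A sign is its own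
        inverse, so this is \<open>p * ?e (s k)\<close>.\<close>
      have "p = ?e (s k) * (\<Prod>i\<in>-{k}. ?e (s i))"
        unfolding p_def by (subst prod.remove[of _ k]) (auto simp: Compl_eq_Diff_UNIV)
      then have "p * ?e (s k) = (\<Prod>i\<in>-{k}. ?e (s i))"
        using e1(3)[of "s k"] by (simp add: mult.commute mult.left_commute)
      then show ?thesis
        unfolding face_scale by (simp add: c_def mult.assoc[symmetric])
    qed
    have "?I = (\<integral>\<^sup>+x. ennreal (\<bar>face j (\<lambda>i. c s i *\<^sub>R x i)\<bar> * of_bool (same_sign (\<lambda>k. face k (\<lambda>i. c s i *\<^sub>R x i)))) \<partial>?P)"
      by (rule sphere_PiM_orthogonal[where T="\<lambda>i (v::real^'n). c s i *\<^sub>R v" and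
            f="\<lambda>x. ennreal (\<bar>face j x\<bar> * of_bool (same_sign (\<lambda>k. face k x)))"], rule orth)
         (unfold of_bool_def, measurable)
    then show ?thesis
      unfolding face same_sign_scale[OF p(1)] by (simp only: abs_mult p e1 mult_1)
  qed
  have "2 ^ CARD('n) * ?I = (\<Sum>s\<in>(UNIV :: ('n \<Rightarrow> bool) set). ?I)"
    by (simp add: card_fun)
  also have "\<dots> = (\<Sum>s\<in>UNIV. \<integral>\<^sup>+x. ennreal (\<bar>face j x\<bar> * of_bool (same_sign (\<lambda>k. ?e (s k) * face k x))) \<partial>?P)"
    by (intro sum.cong refl flip)
  also have "\<dots> = (\<integral>\<^sup>+x. (\<Sum>s\<in>UNIV. ennreal (\<bar>face j x\<bar> * of_bool (same_sign (\<lambda>k. ?e (s k) * face k x)))) \<partial>?P)"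
    by (rule nn_integral_sum[symmetric]) (unfold of_bool_def, measurable)
  also have "\<dots> = (\<integral>\<^sup>+x. 2 * ennreal \<bar>face j x\<bar> \<partial>?P)"
  proof (rule nn_integral_cong_AE)
    have "AE x in ?P. \<forall>k\<in>UNIV. face k x \<noteq> 0"
      by (rule AE_finite_allI) (auto intro: face_AE_nonzero)
    then show "AE x in ?P. (\<Sum>s\<in>UNIV. ennreal (\<bar>face j x\<bar> * of_bool (same_sign (\<lambda>k. ?e (s k) * face k x)))) = 2 * ennreal \<bar>face j x\<bar>"
    proof eventually_elim
      case (elim x)
      have "(\<Sum>s\<in>UNIV. \<bar>face j x\<bar> * of_bool (same_sign (\<lambda>k. ?e (s k) * face k x)))
          = \<bar>face j x\<bar> * real (card {s. same_sign (\<lambda>k. ?e (s k) * face k x)})"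
        by (simp add: sum_distrib_left[symmetric] Collect_conj_eq flip: sum.inter_filter)
      also have "\<dots> = 2 * \<bar>face j x\<bar>"
        using elim by (subst count_sign_patterns) auto
      finally have sum: "(\<Sum>s\<in>UNIV. \<bar>face j x\<bar> * of_bool (same_sign (\<lambda>k. ?e (s k) * face k x))) = 2 * \<bar>face j x\<bar>" .
      have "(\<Sum>s\<in>UNIV. ennreal (\<bar>face j x\<bar> * of_bool (same_sign (\<lambda>k. ?e (s k) * face k x)))) = ennreal (2 * \<bar>face j x\<bar>)"
        unfolding sum[symmetric] by (rule sum_ennreal) simp
      then show ?case
        by (simp only: ennreal_mult'[of 2] ennreal_numeral zero_le_numeral)
    qed
  qed
  also have "\<dots> = 2 * abs_det_moment (UNIV :: 'n set)"
    unfolding nn_integral_abs_face[of j, symmetric] by (rule nn_integral_cmult) measurable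
  finally show ?thesis .
qed

lemma AE_sphere_PiM_norm:
  "AE x in (sphere_PiM UNIV :: ('i::finite \<Rightarrow> 'a::euclidean_space) measure). \<forall>i\<in>UNIV. norm (x i) = 1"
proof (rule AE_finite_allI)
  fix i :: 'i
  show "AE x in (sphere_PiM UNIV :: ('i \<Rightarrow> 'a) measure). norm (x i) = 1"
    using AE_uniform_sphere by (intro AE_PiM_component prob_space_uniform_sphere) auto
qed simp

text \<open>Changing the sign of \<open>x None\<close> negates all faces and keeps
  \<open>base\<close>, so the integral equals the one with a plus sign; adding the two eliminates
  \<open>base\<close>.\<close>

lemma nn_integral_simplex:
  "(\<integral>\<^sup>+x. ennreal (\<bar>base x - (\<Sum>j\<in>(UNIV::'n::finite set). face j x)\<bar> * of_bool (same_sign (\<lambda>j. face j x))) \<partial>sphere_PiM UNIV)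
    = (\<Sum>j\<in>(UNIV::'n set). \<integral>\<^sup>+x. ennreal (\<bar>face j x\<bar> * of_bool (same_sign (\<lambda>j. face j x))) \<partial>sphere_PiM UNIV)"
    (is "?I = ?J")
proof -
  let ?P = "sphere_PiM (UNIV :: 'n option set) :: ('n option \<Rightarrow> real ^ 'n) measure"
  let ?b = "\<lambda>x. of_bool (same_sign (\<lambda>j. face (j::'n) x)) :: real"
  let ?S = "\<lambda>x. \<Sum>j\<in>(UNIV::'n set). face j x"
  define c where "c i = (case i of None \<Rightarrow> - 1 :: real | Some k \<Rightarrow> 1)" for i :: "'n option"
  have c: "c i = 1 \<or> c i = - 1" for i
    by (auto simp: c_def split: option.split)
  have orth: "orthogonal_transformation (\<lambda>v::real^'n. c i *\<^sub>R v)" for i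
    using c[of i] by (auto simp: orthogonal_transformation_def linear_iff scaleR_right_distrib)
  have sc: "face k (\<lambda>i. c i *\<^sub>R x i) = - 1 * face k x" "base (\<lambda>i. c i *\<^sub>R x i) = base x" for k x
    unfolding face_scale base_scale by (simp_all add: c_def)
  have "?I = (\<integral>\<^sup>+x. ennreal (\<bar>base (\<lambda>i. c i *\<^sub>R x i) - ?S (\<lambda>i. c i *\<^sub>R x i)\<bar> * ?b (\<lambda>i. c i *\<^sub>R x i)) \<partial>?P)"
    by (rule sphere_PiM_orthogonal[where T="\<lambda>i (v::real^'n). c i *\<^sub>R v" and f="\<lambda>x. ennreal (\<bar>base x - ?S x\<bar> * ?b x)"], rule orth)
       (unfold of_bool_def, measurable)
  also have "\<dots> = (\<integral>\<^sup>+x. ennreal (\<bar>base x + ?S x\<bar> * ?b x) \<partial>?P)"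
    unfolding sc same_sign_scale[of "- 1", simplified] by (simp add: sum_negf same_sign_scale[of "- 1", simplified])
  finally have flip: "?I = (\<integral>\<^sup>+x. ennreal (\<bar>base x + ?S x\<bar> * ?b x) \<partial>?P)" .
  have "2 * ?I = ?I + ?I"
    by (rule mult_2)
  also have "\<dots> = (\<integral>\<^sup>+x. ennreal (\<bar>base x - ?S x\<bar> * ?b x) \<partial>?P) + (\<integral>\<^sup>+x. ennreal (\<bar>base x + ?S x\<bar> * ?b x) \<partial>?P)"
    by (rule arg_cong2[where f=plus, OF refl flip])
  also have "\<dots> = (\<integral>\<^sup>+x. ennreal (\<bar>base x - ?S x\<bar> * ?b x) + ennreal (\<bar>base x + ?S x\<bar> * ?b x) \<partial>?P)"
    by (rule nn_integral_add[symmetric]) (unfold of_bool_def, measurable)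
  also have "\<dots> = (\<integral>\<^sup>+x. 2 * (\<Sum>j\<in>(UNIV::'n set). ennreal (\<bar>face j x\<bar> * ?b x)) \<partial>?P)"
  proof (rule nn_integral_cong_AE)
    show "AE x in ?P. ennreal (\<bar>base x - ?S x\<bar> * ?b x) + ennreal (\<bar>base x + ?S x\<bar> * ?b x)
      = 2 * (\<Sum>j\<in>(UNIV::'n set). ennreal (\<bar>face j x\<bar> * ?b x))"
      using AE_sphere_PiM_norm
    proof eventually_elim
      case (elim x)
      have "\<bar>base x - ?S x\<bar> * ?b x + \<bar>base x + ?S x\<bar> * ?b x = 2 * (\<Sum>j\<in>(UNIV::'n set). \<bar>face j x\<bar> * ?b x)"
      proof (cases "same_sign (\<lambda>j. face j x)")
        case True
        \<comment> \<open>Equal signs turn the bound from Cramer's rule into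
          \<open>\<bar>base x\<bar> \<le> \<bar>?S x\<bar>\<close>, which makes the two absolute
          values add up to \<open>2 * \<bar>?S x\<bar>\<close>.\<close>
        have "\<bar>base x\<bar> \<le> (\<Sum>j\<in>UNIV. \<bar>face j x\<bar>)"
          unfolding base_def face_eq by (rule abs_det_rows_le) (rule bspec[OF elim UNIV_I])+
        also have "\<dots> = \<bar>?S x\<bar>"
          using same_sign_abs_sum[OF True] by simp
        finally have "\<bar>base x - ?S x\<bar> + \<bar>base x + ?S x\<bar> = 2 * \<bar>?S x\<bar>"
          by linarith
        then show ?thesis
          using True same_sign_abs_sum[OF True] by simp
      qed simp
      note eq = this
      have "(\<Sum>j\<in>(UNIV::'n set). ennreal (\<bar>face j x\<bar> * ?b x)) = ennreal (\<Sum>j\<in>(UNIV::'n set). \<bar>face j x\<bar> * ?b x)"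
        by (rule sum_ennreal) simp
      then have "2 * (\<Sum>j\<in>(UNIV::'n set). ennreal (\<bar>face j x\<bar> * ?b x)) = ennreal (2 * (\<Sum>j\<in>(UNIV::'n set). \<bar>face j x\<bar> * ?b x))"
        by (simp only: ennreal_mult'[of 2] ennreal_numeral zero_le_numeral)
      also have "\<dots> = ennreal (\<bar>base x - ?S x\<bar> * ?b x) + ennreal (\<bar>base x + ?S x\<bar> * ?b x)"
        unfolding eq[symmetric] by (rule ennreal_plus) simp_all
      finally show ?case ..
    qed
  qed
  also have "\<dots> = 2 * (\<integral>\<^sup>+x. (\<Sum>j\<in>(UNIV::'n set). ennreal (\<bar>face j x\<bar> * ?b x)) \<partial>?P)"
    by (rule nn_integral_cmult) (unfold of_bool_def, measurable)
  also have "(\<integral>\<^sup>+x. (\<Sum>j\<in>(UNIV::'n set). ennreal (\<bar>face j x\<bar> * ?b x)) \<partial>?P) = ?J"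
    by (rule nn_integral_sum) (unfold of_bool_def, measurable)
  finally show ?thesis
    by (simp add: ennreal_mult_cancel_left)
qed

text \<open>Each of the \<open>CARD('n)\<close> faces contributes \<open>2 / 2 ^ CARD('n)\<close>
  times the mean absolute determinant.\<close>

lemma nn_integral_simplex_value:
  "(\<integral>\<^sup>+x. ennreal (\<bar>base x - (\<Sum>j\<in>(UNIV::'n::finite set). face j x)\<bar> * of_bool (same_sign (\<lambda>j. face j x))) \<partial>sphere_PiM UNIV)
    = ennreal (real CARD('n) / 2 ^ (CARD('n) - 1) *
       (Gamma ((real CARD('n) + 1) / 2) / sqrt pi * (Gamma (real CARD('n) / 2) / Gamma ((real CARD('n) + 1) / 2)) ^ CARD('n)))"
    (is "?I = ennreal (_ / _ * ?w)")
proof -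
  let ?J = "\<lambda>j::'n. \<integral>\<^sup>+x. ennreal (\<bar>face j x\<bar> * of_bool (same_sign (\<lambda>k. face k x))) \<partial>sphere_PiM UNIV"
  have w: "0 \<le> ?w"
    by (intro mult_nonneg_nonneg divide_nonneg_nonneg zero_le_power Gamma_real_nonneg) auto
  obtain m where m: "CARD('n) = Suc m"
    using not0_implies_Suc[of "CARD('n)"] by auto
  have "?J j = ennreal (?w / 2 ^ (CARD('n) - 1))" for j :: 'n
  proof -
    have "ennreal (2 ^ CARD('n)) * ?J j = ennreal (2 ^ CARD('n)) * ennreal (?w / 2 ^ (CARD('n) - 1))"
    proof -
      have "ennreal (2 ^ CARD('n)) = 2 ^ CARD('n)"
        by (simp flip: ennreal_power)
      then have "ennreal (2 ^ CARD('n)) * ?J j = ennreal 2 * ennreal ?w"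
        using nn_integral_face_same_sign[of j] by (simp only: abs_det_moment[of UNIV] ennreal_numeral)
      also have "\<dots> = ennreal (2 * ?w)"
        by (rule ennreal_mult[symmetric]) (use w in simp_all)
      also have "2 * ?w = 2 ^ CARD('n) * (?w / 2 ^ (CARD('n) - 1))"
        by (simp only: m diff_Suc_1 power_Suc) simp
      finally show ?thesis
        using w by (subst ennreal_mult[symmetric]) auto
    qed
    then show ?thesis
      by (subst (asm) ennreal_mult_cancel_left) auto
  qed
  then have "?I = (\<Sum>j\<in>(UNIV::'n set). ennreal (?w / 2 ^ (CARD('n) - 1)))"
    unfolding nn_integral_simplex by simp
  also have "\<dots> = ennreal (real CARD('n) / 2 ^ (CARD('n) - 1) * ?w)"
    using w by (subst sum_ennreal) (simp_all del: sum_constant add: sum_constant_scaleR)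
  finally show ?thesis .
qed

section \<open>From random variables to the product measure\<close>

text \<open>Independence makes the joint distribution over \<open>I\<close> a product; selecting
  coordinates along \<open>g\<close> moves it to the finite index type on which the integrals are
  computed.\<close>

lemma joint_distr_reindex:
  fixes g :: "'i::finite \<Rightarrow> nat" and U :: "nat \<Rightarrow> 'w \<Rightarrow> 'a::euclidean_space"
  assumes prob: "prob_space M"
    and indep: "prob_space.indep_vars M (\<lambda>_. borel) U I"
    and uniform: "\<And>i. i \<in> I \<Longrightarrow> distr M borel (U i) = uniform_sphere"
    and g: "inj g" "range g \<subseteq> I"
  shows "(\<lambda>\<omega> i. U (g i) \<omega>) \<in> measurable M (sphere_PiM UNIV)"
    and "distr M (sphere_PiM UNIV) (\<lambda>\<omega> i. U (g i) \<omega>) = sphere_PiM UNIV"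
proof -
  interpret prob_space M by (rule prob)
  have rv: "U i \<in> borel_measurable M" if "i \<in> I" for i
    using indep that by (auto simp: indep_vars_def)
  have I: "I \<noteq> {}" using g(2) by auto
  let ?U = "\<lambda>\<omega>. \<lambda>i\<in>I. U i \<omega>"
  have sets: "sets (\<Pi>\<^sub>M i\<in>I. borel) = sets (sphere_PiM I :: (nat \<Rightarrow> 'a) measure)"
    by (intro sets_PiM_cong) auto
  have U: "?U \<in> measurable M (sphere_PiM I)"
    using rv by (intro measurable_restrict) (simp add: measurable_cong_sets[OF refl sets_uniform_sphere])
  have "distr M (\<Pi>\<^sub>M i\<in>I. borel) ?U = (\<Pi>\<^sub>M i\<in>I. distr M borel (U i))"
    using indep_vars_iff_distr_eq_PiM'[OF I, where M'="\<lambda>_. borel" and X=U] indep rv by simp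
  also have "\<dots> = sphere_PiM I"
    using uniform by (intro PiM_cong) auto
  finally have distr: "distr M (sphere_PiM I) ?U = sphere_PiM I"
    using sets by (simp cong: distr_cong)
  let ?r = "\<lambda>x. \<lambda>i\<in>UNIV. x (g i)"
  have r: "?r \<in> measurable (sphere_PiM I) (sphere_PiM UNIV :: ('i \<Rightarrow> 'a) measure)"
    using g(2) by (intro measurable_restrict measurable_component_singleton) auto
  have eq: "(\<lambda>\<omega> i. U (g i) \<omega>) = ?r \<circ> ?U"
    using g(2) by (auto simp: fun_eq_iff)
  show "(\<lambda>\<omega> i. U (g i) \<omega>) \<in> measurable M (sphere_PiM UNIV)"
    unfolding eq using U r by (rule measurable_comp)
  have "distr M (sphere_PiM UNIV) (?r \<circ> ?U) = distr (distr M (sphere_PiM I) ?U) (sphere_PiM UNIV) ?r"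
    by (rule distr_distr[symmetric, OF r U])
  also have "\<dots> = distr (sphere_PiM I) (sphere_PiM UNIV) ?r"
    unfolding distr ..
  also have "\<dots> = sphere_PiM UNIV"
    using g by (intro distr_PiM_reindex prob_space_uniform_sphere) auto
  finally show "distr M (sphere_PiM UNIV) (\<lambda>\<omega> i. U (g i) \<omega>) = sphere_PiM UNIV"
    unfolding eq .
qed

theorem theorem2:
  fixes M :: "'w measure" and U :: "nat \<Rightarrow> 'w \<Rightarrow> real ^ 'n" and d :: nat
  assumes d_def: "d = CARD('n)"
    and d_ge_2: "d \<ge> 2"
    and prob: "prob_space M"
    and indep: "prob_space.indep_vars M (\<lambda>_. borel) U {0..d}"
    and uniform: "\<And>i. i \<in> {0..d} \<Longrightarrow> distr M borel (U i) = uniform_sphere"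
  shows "prob_space.expectation M
           (\<lambda>\<omega>. measure lborel (convex hull ((\<lambda>i. U i \<omega>) ` {0..d})) *
              of_bool (0 \<in> rel_interior (convex hull ((\<lambda>i. proj_perp (U 0 \<omega>) (U i \<omega>)) ` {1..d}))))
         = 1 / (2 ^ (d - 1) * sqrt pi * fact (d - 1)) *
             (Gamma (real d / 2) ^ d / Gamma ((real d + 1) / 2) ^ (d - 1))"
proof -
  interpret prob_space M by (rule prob)
  let ?P = "sphere_PiM UNIV :: ('n option \<Rightarrow> real ^ 'n) measure"
  \<comment> \<open>The points of index 1 to \<open>d\<close> are matched with the matrix rows in an
    arbitrary order; index 0 corresponds to \<open>None\<close>.\<close>
  have "\<exists>h. bij_betw h (UNIV :: 'n set) {1..d}"
    by (rule finite_same_card_bij) (simp_all add: d_def)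
  then obtain h :: "'n \<Rightarrow> nat" where h: "bij_betw h UNIV {1..d}"
    by blast
  define g where "g i = (case i of None \<Rightarrow> 0 | Some k \<Rightarrow> h k)" for i
  define V where "V \<omega> i = U (g i) \<omega>" for \<omega> i
  have img1: "{1..d} = range h"
    using h by (simp add: bij_betw_def)
  have img0: "{0..d} = insert 0 (range h)"
    unfolding img1[symmetric] by auto
  have h_pos: "h k \<noteq> 0" for k
  proof -
    have "h k \<in> {1..d}" unfolding img1 by (rule rangeI)
    then show ?thesis by simp
  qed
  have h_inj: "h k = h l \<longleftrightarrow> k = l" for k l
    using bij_betw_imp_inj_on[OF h] by (rule inj_eq)
  have inj_g: "inj g"
  proof (rule injI)
    fix i j assume "g i = g j"
    then show "i = j"
      using h_pos h_pos[symmetric] by (cases i; cases j) (simp_all add: g_def h_inj)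
  qed
  have "g i \<in> {0..d}" for i
    unfolding img0 by (cases i) (simp_all add: g_def)
  then have g: "inj g" "range g \<subseteq> {0..d}"
    using inj_g by blast+
  have V[measurable]: "V \<in> measurable M ?P" and dV: "distr M ?P V = ?P"
    using joint_distr_reindex[OF prob indep uniform g] by (simp_all add: V_def[abs_def])
  \<comment> \<open>The determinantal form of the integrand, in which measurability is
    visible.\<close>
  define F where "F x = \<bar>base x - (\<Sum>j\<in>(UNIV::'n set). face j x)\<bar> * of_bool (same_sign (\<lambda>j. face j x)) / fact d" for x
  have F[measurable]: "F \<in> borel_measurable ?P"
    unfolding F_def of_bool_def by measurable
  have F0: "0 \<le> F x" for x
    by (simp add: F_def)
  have integrand: "measure lborel (convex hull ((\<lambda>i. U i \<omega>) ` {0..d})) *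
      of_bool (0 \<in> rel_interior (convex hull ((\<lambda>i. proj_perp (U 0 \<omega>) (U i \<omega>)) ` {1..d}))) = F (V \<omega>)" for \<omega>
  proof -
    have V: "V \<omega> None = U 0 \<omega>" "V \<omega> (Some i) = U (h i) \<omega>" for i
      by (simp_all add: V_def g_def)
    show ?thesis
      unfolding img0 unfolding img1 image_insert image_image F_def base_def face_eq V
      unfolding d_def by (rule measure_simplex_of_bool)
  qed
  have "(\<integral>\<^sup>+\<omega>. ennreal (F (V \<omega>)) \<partial>M) = (\<integral>\<^sup>+x. ennreal (F x) \<partial>distr M ?P V)"
    by (rule nn_integral_distr[symmetric]) measurable
  also have "\<dots> = (\<integral>\<^sup>+x. ennreal (1 / fact d) * ennreal (\<bar>base x - (\<Sum>j\<in>(UNIV::'n set). face j x)\<bar> * of_bool (same_sign (\<lambda>j. face j x))) \<partial>?P)"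
    unfolding dV by (intro nn_integral_cong) (simp add: F_def flip: ennreal_mult)
  also have "\<dots> = ennreal (1 / fact d) * (\<integral>\<^sup>+x. ennreal (\<bar>base x - (\<Sum>j\<in>(UNIV::'n set). face j x)\<bar> * of_bool (same_sign (\<lambda>j. face j x))) \<partial>?P)"
    by (rule nn_integral_cmult) (unfold of_bool_def, measurable)
  also have "\<dots> = ennreal (1 / fact d * (real d / 2 ^ (d - 1) *
       (Gamma ((real d + 1) / 2) / sqrt pi * (Gamma (real d / 2) / Gamma ((real d + 1) / 2)) ^ d)))" (is "_ = ennreal ?c")
    unfolding nn_integral_simplex_value d_def by (rule ennreal_mult'[symmetric]) simp
  finally have nn: "(\<integral>\<^sup>+\<omega>. ennreal (F (V \<omega>)) \<partial>M) = ennreal ?c" .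
  have pos: "0 < Gamma ((real d + 1) / 2)" "0 < Gamma (real d / 2)"
    using d_ge_2 by (auto intro!: Gamma_real_pos)
  have "expectation (\<lambda>\<omega>. F (V \<omega>)) = enn2real (\<integral>\<^sup>+\<omega>. ennreal (F (V \<omega>)) \<partial>M)"
    by (rule integral_eq_nn_integral) (auto simp: F0)
  also have "\<dots> = ?c"
    unfolding nn using pos by (intro enn2real_ennreal mult_nonneg_nonneg divide_nonneg_nonneg zero_le_power) auto
  also have "?c = 1 / (2 ^ (d - 1) * sqrt pi * fact (d - 1)) *
             (Gamma (real d / 2) ^ d / Gamma ((real d + 1) / 2) ^ (d - 1))"
  proof -
    \<comment> \<open>One factor \<open>Gamma ((real d + 1) / 2)\<close> cancels, which lowers the
      exponent to \<open>d - 1\<close>, and \<open>d\<close> cancels in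
      \<open>fact d = d * fact (d - 1)\<close>.\<close>
    obtain m where m: "d = Suc m"
      using d_ge_2 by (cases d) auto
    have "1 / (real d * q) * (real d / e * (b / s * (a / b) ^ d)) = 1 / (e * s * q) * (a ^ d / b ^ (d - 1))"
      if "0 < b" for a b e s q :: real
      using that unfolding m by (simp add: power_divide mult_ac)
    from this[OF pos(1), of "fact (d - 1)" "2 ^ (d - 1)" "sqrt pi" "Gamma (real d / 2)"]
    show ?thesis
      using d_ge_2 by (simp only: fact_reduce[of d, where 'a=real] zero_less_iff_neq_zero)
  qed
  finally show ?thesis
    unfolding integrand .
qed

end
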